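(* In the directed FCFS bipartite matching model, assume the stability condition $\lambda_C<\mu_{\mathcal S(C)}$ for every nonempty $C\subseteq\mathcal C$, and that $\alpha_{c_i}>0$, $\beta_{s_j}>0$ for all $i,j$. (a) A state $U(N)=(u_1,\dots,u_L)$ has positive probability under the stationary distribution of $U$ if and only if it is $\emptyset$, or: it starts with an unmatched agent ($u_1=c_i$ for some $i$), it consists of elements of the forms $c_i,\tilde c_i,\tilde s_j$, and for any $k<l$, if $u_k=c_i$ and $u_l=\tilde s_j$ then $(s_j,c_i)\notin\mathcal G$. (b) A state $W(N)=(w_1,\dots,w_L)$ has positive probability under the stationary distribution of $W$ if and only if it is $\emptyset$, or: it ends with an exchanged agent ($w_L=\tilde c_i$ for some $i$), it consists of elements of the forms $c_i,\tilde c_i,s_j$, and for any $k>l$, if $w_k=\tilde c_i$ and $w_l=s_j$ then $(s_j,c_i)\notin\mathcal G$.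
   Context: Model. $\mathcal C=\{c_1,\dots,c_I\}$ (agent types) and $\mathcal S=\{s_1,\dots,s_J\}$ (good types) are disjoint finite sets, $\mathcal G\subseteq\mathcal S\times\mathcal C$ is a bipartite compatibility graph, $\bar\lambda,\bar\mu>0$, and $\alpha,\beta$ are probability vectors on $\mathcal C,\mathcal S$. Put $\lambda_{c_i}=\bar\lambda\alpha_{c_i}$, $\mu_{s_j}=\bar\mu\beta_{s_j}$. The sequence $(z^n)_{n\in\mathbb Z}$ is i.i.d. with $P(z^n=c_i)=\lambda_{c_i}/(\bar\lambda+\bar\mu)$, $P(z^n=s_j)=\mu_{s_j}/(\bar\lambda+\bar\mu)$. For $C\subseteq\mathcal C$: $\mathcal S(C)=\{s_j:(s_j,c)\in\mathcal G\text{ for some }c\in C\}$, $\lambda_C=\sum_{c\in C}\lambda_c$; for $S\subseteq\mathcal S$: $\mu_S=\sum_{s\in S}\mu_s$. Directed FCFS matching: each item is matched at most once, and a good $z^n=s_j$ is matched with an agent $z^m=c_i$ if and only if (i) $n>m$; (ii) $(s_j,c_i)\in\mathcal G$; (iii) for every $k<m$ with $z^k=c_{i'}$ and $(s_j,c_{i'})\in\mathcal G$ there is $l<n$ such that $z^l$ is matched with $z^k$. A good with no such match remains unmatched (lost). Under the stability condition there is almost surely a unique directed FCFS matching of $(z^n)_{n\in\mathbb Z}$ in which all agents are matched; the processes below refer to it. Exchange: exchanging a matched pair $z^m=c_i$, $z^n=s_j$ ($m<n$) means writing $\tilde s_j$ in position $m$ and $\tilde c_i$ in position $n$. $X(N)$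 is the list, in order of position, of the types of the agents in positions $\le N$ not matched to goods in positions $\le N$. $U(N)$: perform all matches of goods in positions $\le N$ and exchange the matched pairs. If $X(N)=\emptyset$ then $U(N)=\emptyset$. Otherwise let $\underline N$ be the position of the first agent still unmatched; $U(N)=(u_1,\dots,u_L)$, $L=N-\underline N+1$, records positions $\underline N,\dots,N$: the entry is $c_i$ if the position holds a still unmatched agent of type $c_i$; $\tilde s_j$ if it holds a good $s_j$ that remained unmatched, or if it originally held an agent that has been matched and exchanged with a good of type $s_j$ (in a later position $\le N$); $\tilde c_i$ if it originally held a good that has been matched and exchanged with an earlier agent of type $c_i$. $W(N)$: match and exchange all agents in positions $\le N$ (with goods that may lie in positions $>N$), but no agents in positions $>N$. If $X(N)=\emptyset$ then $W(N)=\emptyset$. Otherwise let $\overline N>N$ be the position of the last matched and exchanged good; $W(N)=(w_1,\dots,w_L)$, $L=\overline N-N$, records positions $N+1,\dots,\overline N$: the entry is $c_i$ for an agent of type $c_i$; $s_j$ for a good of type $s_j$ not matched to an agent in position $\le N$; $\tilde c_i$ for a good that has been matched and exchanged with an agent of type $c_i$ in position $\le N$.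
   Formalization: FCFS matchings of all agents are not unique on the integers, so the matching meant is the one with X(N) empty at arbitrarily early N; and the match condition (i)–(iii) also requires that the agent has not already been matched to an earlier good. *)

theory Defs
  imports "HOL-Probability.Probability"
begin

datatype ('c, 's) item = Agent 'c | Good 's

text \<open>Entry of an exchanged configuration; \<open>Exchanged\<close> renders the tilde.\<close>

datatype ('c, 's) entry = Plain "('c, 's) item" | Exchanged "('c, 's) item"

definition compatible_goods :: "('s \<times> 'c) set \<Rightarrow> 'c set \<Rightarrow> 's set" where
  "compatible_goods G C = {s. \<exists>c\<in>C. (s, c) \<in> G}"

text \<open>
  A matching is a set of pairs (position of the agent, position of the good).  The good at \<open>n\<close> takes
  the earliest compatible agent that is still available.  The last conjunct, that the agent at \<open>m\<close>
  itself has not been taken by an earlier good, is what ``each item is matched at most once'' demands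
  of the right-hand side: without it the equivalence would force one agent onto several goods.
\<close>

definition directed_fcfs_matching ::
  "('s \<times> 'c) set \<Rightarrow> (int \<Rightarrow> ('c, 's) item) \<Rightarrow> (int \<times> int) set \<Rightarrow> bool" where
  "directed_fcfs_matching G z A \<longleftrightarrow>
     (\<forall>m n. (m, n) \<in> A \<longrightarrow> (\<exists>c s. z m = Agent c \<and> z n = Good s)) \<and>
     single_valued A \<and> single_valued (A\<inverse>) \<and>
     (\<forall>m n c s. z m = Agent c \<longrightarrow> z n = Good s \<longrightarrow>
        ((m, n) \<in> A \<longleftrightarrow>
           m < n \<and> (s, c) \<in> G \<and>
           (\<forall>k<m. \<forall>c'. z k = Agent c' \<and> (s, c') \<in> G \<longrightarrow> (\<exists>l<n. (k, l) \<in> A)) \<and>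
           \<not> (\<exists>l<n. (m, l) \<in> A)))"

definition all_agents_matched :: "(int \<Rightarrow> ('c, 's) item) \<Rightarrow> (int \<times> int) set \<Rightarrow> bool" where
  "all_agents_matched z A \<longleftrightarrow> (\<forall>m c. z m = Agent c \<longrightarrow> (\<exists>n. (m, n) \<in> A))"

text \<open>
  The positions of the agents listed in \<open>X(N)\<close>.  A set is used because \<open>X(N)\<close> enters below only through
  its emptiness and its first position.
\<close>

definition waiting :: "(int \<Rightarrow> ('c, 's) item) \<Rightarrow> (int \<times> int) set \<Rightarrow> int \<Rightarrow> int set" where
  "waiting z A N = {m. m \<le> N \<and> (\<exists>c. z m = Agent c) \<and> \<not> (\<exists>n\<le>N. (m, n) \<in> A)}"

text \<open>
  On a sequence indexed by all integers, being FCFS and matching all agents does not determine the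
  matching.  With one agent type and one (compatible) good type, enumerate the agent positions as
  \<open>a k\<close> and the good positions as \<open>g k\<close>, in increasing order, for \<open>k\<close> in the integers; goods being more
  frequent, \<open>a k < g (k + r)\<close> for each fixed \<open>r\<close> and all sufficiently small \<open>k\<close>, so one may match \<open>a k\<close>
  with \<open>g (k + r)\<close> until the queue is first empty and be greedy afterwards.  All these satisfy both
  requirements, but have queues growing without bound towards the infinite past.  The matching meant
  is the one whose queue is empty at arbitrarily early times.
\<close>

definition the_matching :: "('s \<times> 'c) set \<Rightarrow> (int \<Rightarrow> ('c, 's) item) \<Rightarrow> (int \<times> int) set" where
  "the_matching G z =
     (THE A. directed_fcfs_matching G z A \<and> all_agents_matched z A \<and>
             (\<forall>N. \<exists>N'\<le>N. waiting z A N' = {}))"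

text \<open>The entry at position \<open>p\<close> after exchanging exactly the matched pairs in \<open>B\<close>.\<close>

definition exchange ::
  "(int \<Rightarrow> ('c, 's) item) \<Rightarrow> (int \<times> int) set \<Rightarrow> int \<Rightarrow> ('c, 's) entry" where
  "exchange z B p =
     (if \<exists>n. (p, n) \<in> B then Exchanged (z (THE n. (p, n) \<in> B))
      else if \<exists>m. (m, p) \<in> B then Exchanged (z (THE m. (m, p) \<in> B))
      else Plain (z p))"

text \<open>In \<open>U(N)\<close> a lost good is recorded in the same way as an exchanged one.\<close>

fun mark_lost :: "('c, 's) entry \<Rightarrow> ('c, 's) entry" where
  "mark_lost (Plain (Good s)) = Exchanged (Good s)"
| "mark_lost e = e"

definition U :: "('s \<times> 'c) set \<Rightarrow> (int \<Rightarrow> ('c, 's) item) \<Rightarrow> int \<Rightarrow> ('c, 's) entry list" where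
  "U G z N =
     (let A = the_matching G z; B = {(m, n). (m, n) \<in> A \<and> n \<le> N} in
      if waiting z A N = {} then []
      else map (\<lambda>p. mark_lost (exchange z B p)) [Min (waiting z A N)..N])"

definition W :: "('s \<times> 'c) set \<Rightarrow> (int \<Rightarrow> ('c, 's) item) \<Rightarrow> int \<Rightarrow> ('c, 's) entry list" where
  "W G z N =
     (let A = the_matching G z; B = {(m, n). (m, n) \<in> A \<and> m \<le> N} in
      if waiting z A N = {} then []
      else map (exchange z B) [N + 1..Max {n. N < n \<and> (\<exists>m. (m, n) \<in> B)}])"

text \<open>\<open>\<pi>\<close> is the one-dimensional marginal of the strictly stationary process \<open>X\<close>.\<close>

definition stationary_distribution :: "'w measure \<Rightarrow> (int \<Rightarrow> 'w \<Rightarrow> 'a) \<Rightarrow> 'a pmf \<Rightarrow> bool" where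
  "stationary_distribution M X \<pi> \<longleftrightarrow>
     (\<forall>n. X n \<in> measurable M (count_space UNIV)) \<and>
     (\<forall>k. distr M (\<Pi>\<^sub>M n\<in>UNIV. count_space UNIV) (\<lambda>\<omega> n. X (n + k) \<omega>) =
          distr M (\<Pi>\<^sub>M n\<in>UNIV. count_space UNIV) (\<lambda>\<omega> n. X n \<omega>)) \<and>
     (\<forall>n. distr M (count_space UNIV) (X n) = measure_pmf \<pi>)"

end

theory Submission
  imports Defs "HOL-Library.Sublist"
begin

text \<open>
  Started empty at time \<open>k\<close>, the queue at time \<open>N\<close> increases as \<open>k\<close> decreases.  The explicit product-form
  invariant distribution of the queue bounds the probability of an empty queue from below, uniformly
  in \<open>k\<close>; hence with positive probability the queue at \<open>N\<close> is empty for every \<open>k \<le> N\<close>, and by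
  Kolmogorov's 0-1 law and stationarity there are almost surely such regenerations arbitrarily early
  and late.  Between two regenerations the matching is forced, so \<open>U(N)\<close> and \<open>W(N)\<close> are functions of the
  finite word between them.  As a regeneration is independent of the later items, of which every finite
  word has positive probability, a state has positive probability iff some finite word produces it.
  For \<open>W\<close>, one waiting agent for every exchanged entry does this; for \<open>U\<close>, the word is found by running
  the exchange dynamics backwards.
\<close>

section \<open>Queues and exchanged records of finite words\<close>

text \<open>The matching is specified on all of Z, so there is no first item from which to run a
  recursion. A regeneration provides one: \<open>empty_at\<close> demands emptiness for every start
  \<open>k\<close>, hence any admissible matching, whatever its own early empty times are, has an
  empty queue there. A regeneration is an event about the infinite past, the limit of decreasing
  events about longer and longer finite blocks. Only a bound independent of the length of the block
  survives this limit; the mass that the invariant distribution gives to the empty queue is such a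
  bound. The 0-1 law gives the early regenerations only. Since a regeneration depends on the whole
  past, having late ones is not a tail event of the future, and stationarity has to replace the 0-1
  law. Off the almost sure event \<open>regenerative\<close>, \<open>the_matching\<close> may be an
  unspecified value and nothing is known about measurability of \<open>U\<close> and
  \<open>W\<close>; this is why the processes live on the completion of \<open>M\<close>.\<close>

primrec remove_first :: "('a \<Rightarrow> bool) \<Rightarrow> 'a list \<Rightarrow> 'a list" where
  "remove_first P [] = []"
| "remove_first P (a # as) = (if P a then as else a # remove_first P as)"

lemma remove_first_none: "\<forall>x\<in>set xs. \<not> P x \<Longrightarrow> remove_first P xs = xs"
  by (induction xs) auto

lemma map_remove_first: "map f (remove_first (\<lambda>x. P (f x)) xs) = remove_first P (map f xs)"
  by (induction xs) auto

lemma set_remove_first_subset: "set (remove_first P xs) \<subseteq> set xs"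
  by (induction xs) auto

text \<open>If an extra head of the longer list is the entry removed there, the shorter list loses a
  later entry or none, and still is a subsequence of the rest. This monotonicity makes the queue
  grow with the past and stay below the stationary one.\<close>

lemma subseq_remove_first:
  "subseq xs ys \<Longrightarrow> subseq (remove_first P xs) (remove_first P ys)"
proof (induction rule: list_emb.induct)
  case (list_emb_Cons xs ys y)
  have "subseq (remove_first P xs) xs"
    by (induction xs) auto
  then show ?case
    using list_emb_Cons by (auto intro: subseq_order.trans)
qed auto

text \<open>The loss is written as the set of minimal elements satisfying \<open>P\<close>, empty or
  a singleton. This is the form in which \<open>first_match\<close> removes an agent, and it avoids
  a case distinction.\<close>

lemma sorted_remove_first:
  fixes ps :: "int list"
  assumes "sorted_wrt (<) ps"
  shows "sorted_wrt (<) (remove_first P ps)"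
    and "set (remove_first P ps) = set ps - {m \<in> set ps. P m \<and> (\<forall>k\<in>set ps. k < m \<longrightarrow> \<not> P k)}"
  using assms
proof (induction ps)
  case (Cons a ps)
  { case 1
    then show ?case using Cons set_remove_first_subset[of P ps] by auto
  next
    case 2
    then show ?case using Cons by (auto split: if_splits)
  }
qed auto

definition serve :: "('s \<times> 'c) set \<Rightarrow> 'c list \<Rightarrow> ('c, 's) item \<Rightarrow> 'c list" where
  "serve G q i =
    (case i of Agent c \<Rightarrow> q @ [c] | Good s \<Rightarrow> remove_first (\<lambda>c. (s, c) \<in> G) q)"

lemma subseq_serve: "subseq q q' \<Longrightarrow> subseq (serve G q i) (serve G q' i)"
  by (auto simp: serve_def subseq_remove_first split: item.split)

lemma subseq_foldl_serve: "subseq q q' \<Longrightarrow> subseq (foldl (serve G) q v) (foldl (serve G) q' v)"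
  by (induction v arbitrary: q q') (auto simp: subseq_serve)

lemma foldl_serve_agents: "foldl (serve G) q (map Agent cs) = q @ cs"
  by (induction cs arbitrary: q) (auto simp: serve_def)

section \<open>Records of the past: states of the form \<open>U\<close>\<close>

fun exchanged :: "('c, 's) entry \<Rightarrow> ('c, 's) entry" where
  "exchanged (Plain i) = Exchanged i"
| "exchanged (Exchanged i) = Exchanged i"

definition plain_agent :: "('c, 's) entry \<Rightarrow> bool" where
  "plain_agent e \<longleftrightarrow> (\<exists>c. e = Plain (Agent c))"

definition servable :: "('s \<times> 'c) set \<Rightarrow> 's \<Rightarrow> ('c, 's) entry \<Rightarrow> bool" where
  "servable G s e \<longleftrightarrow> (\<exists>c. e = Plain (Agent c) \<and> (s, c) \<in> G)"

text \<open>The plain agents of a record are the waiting ones, so the record alone determines the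
  next match and no separate queue is carried along. A lost good enters as \<open>Exchanged\<close>
  at once, which is the convention of \<open>mark_lost\<close>.\<close>

definition record_step ::
  "('s \<times> 'c) set \<Rightarrow> ('c, 's) entry list \<Rightarrow> ('c, 's) item \<Rightarrow> ('c, 's) entry list" where
  "record_step G v i = (case i of
      Agent c \<Rightarrow> v @ [Plain (Agent c)]
    | Good s \<Rightarrow> (case dropWhile (\<lambda>e. \<not> servable G s e) v of
          [] \<Rightarrow> v @ [Exchanged (Good s)]
        | e # b \<Rightarrow> takeWhile (\<lambda>e. \<not> servable G s e) v @ Exchanged (Good s) # b @ [exchanged e]))"

lemma record_step_Agent: "record_step G v (Agent c) = v @ [Plain (Agent c)]"
  by (simp add: record_step_def)

lemma record_step_lost:
  assumes "\<And>e. e \<in> set v \<Longrightarrow> \<not> servable G s e"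
  shows "record_step G v (Good s) = v @ [Exchanged (Good s)]"
proof -
  have *: "dropWhile (\<lambda>e. \<not> servable G s e) v = []"
    using assms by (simp add: dropWhile_eq_Nil_conv)
  show ?thesis unfolding record_step_def by (simp only: item.case * list.case)
qed

lemma record_step_match:
  assumes "\<And>e. e \<in> set a \<Longrightarrow> \<not> servable G s e" and "(s, c) \<in> G"
  shows "record_step G (a @ Plain (Agent c) # b) (Good s) =
    a @ Exchanged (Good s) # b @ [Exchanged (Agent c)]"
proof -
  have "servable G s (Plain (Agent c))" using assms by (auto simp: servable_def)
  then have "dropWhile (\<lambda>e. \<not> servable G s e) (a @ Plain (Agent c) # b) = Plain (Agent c) # b"
    and "takeWhile (\<lambda>e. \<not> servable G s e) (a @ Plain (Agent c) # b) = a"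
    using assms(1) by (auto simp: dropWhile_append takeWhile_append)
  then show ?thesis by (simp add: record_step_def)
qed

lemma record_step_cases:
  obtains (Agent) c where "i = Agent c" "record_step G v i = v @ [Plain (Agent c)]"
  | (lost) s where "i = Good s" "\<forall>e\<in>set v. \<not> servable G s e"
      "record_step G v i = v @ [Exchanged (Good s)]"
  | (match) s a c b where "i = Good s" "v = a @ Plain (Agent c) # b" "(s, c) \<in> G"
      "\<forall>e\<in>set a. \<not> servable G s e"
      "record_step G v i = a @ Exchanged (Good s) # b @ [Exchanged (Agent c)]"
proof (cases i)
  case (Good s)
  show ?thesis
  proof (cases "\<exists>e\<in>set v. servable G s e")
    case True
    then obtain a e b where v: "v = a @ e # b" "servable G s e" "\<forall>e\<in>set a. \<not> servable G s e"
      by (metis split_list_first_prop)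
    then obtain c where c: "e = Plain (Agent c)" "(s, c) \<in> G"
      by (auto simp: servable_def)
    have "record_step G v i = a @ Exchanged (Good s) # b @ [Exchanged (Agent c)]"
      unfolding v(1) c(1) Good by (rule record_step_match) (use v(3) c(2) in auto)
    then show ?thesis
      by (rule match[OF Good v(1)[unfolded c(1)] c(2) v(3)])
  next
    case False
    then have "record_step G v (Good s) = v @ [Exchanged (Good s)]"
      by (intro record_step_lost) auto
    with False Good show ?thesis
      by (intro lost[of s]) auto
  qed
next
  case (Agent c)
  then show ?thesis
    using that(1)[of c] by (simp add: record_step_Agent)
qed

text \<open>A relation between two entries, so that the ordering condition becomes
  \<open>sorted_wrt\<close> and splits along appends.\<close>

definition no_overlook :: "('s \<times> 'c) set \<Rightarrow> ('c, 's) entry \<Rightarrow> ('c, 's) entry \<Rightarrow> bool" where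
  "no_overlook G e f \<longleftrightarrow> (\<forall>c s. e = Plain (Agent c) \<and> f = Exchanged (Good s) \<longrightarrow> (s, c) \<notin> G)"

lemma no_overlook_simps [simp]:
  "no_overlook G (Exchanged i) f" "no_overlook G e (Plain i)" "no_overlook G e (Exchanged (Agent c))"
  by (auto simp: no_overlook_def)

lemma no_overlook_Exchanged_Good: "no_overlook G e (Exchanged (Good s)) \<longleftrightarrow> \<not> servable G s e"
  by (auto simp: no_overlook_def servable_def)

definition record_entries :: "('c, 's) entry set" where
  "record_entries =
    {e. (\<exists>c. e = Plain (Agent c)) \<or> (\<exists>c. e = Exchanged (Agent c)) \<or> (\<exists>s. e = Exchanged (Good s))}"

definition valid_record :: "('s \<times> 'c) set \<Rightarrow> ('c, 's) entry list \<Rightarrow> bool" where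
  "valid_record G v \<longleftrightarrow> sorted_wrt (no_overlook G) v \<and> set v \<subseteq> record_entries"

text \<open>An exchanged good is written either at the end, when no entry is servable, or in place
  of the first servable entry; in both cases nothing before it is servable. A plain or exchanged
  agent appended at the end violates nothing.\<close>

lemma valid_record_step:
  assumes "valid_record G v"
  shows "valid_record G (record_step G v i)"
proof (cases rule: record_step_cases[where G = G and v = v and i = i])
  case (Agent c)
  show ?thesis
    unfolding Agent(2) using assms
    by (simp add: valid_record_def sorted_wrt_append record_entries_def)
next
  case (lost s)
  show ?thesis
    unfolding lost(3) using assms lost(2)
    by (simp add: valid_record_def sorted_wrt_append record_entries_def no_overlook_Exchanged_Good)
next
  case (match s a c b)
  show ?thesis
    unfolding match(5) using assms match(4) unfolding match(2)
    by (simp add: valid_record_def sorted_wrt_append record_entries_def no_overlook_Exchanged_Good)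
qed

lemma valid_record_foldl: "valid_record G v \<Longrightarrow> valid_record G (foldl (record_step G) v w)"
  by (induction w arbitrary: v) (auto simp: valid_record_step)

lemma valid_record_append_iff:
  "valid_record G (a @ b) \<longleftrightarrow>
    valid_record G a \<and> valid_record G b \<and> (\<forall>e\<in>set a. \<forall>f\<in>set b. no_overlook G e f)"
  by (auto simp: valid_record_def sorted_wrt_append)

text \<open>
  The word producing a valid record is found by undoing its last entry.  A final exchanged agent is
  undone at the last exchanged good compatible with it, which restores validity; if there is none, the
  agent is put in front of the record instead, at the cost of one more good in the prefix.  Either way
  the length of the record plus the number of its exchanged agents decreases.
\<close>

lemma valid_record_reachable:
  fixes G :: "('s \<times> 'c) set"
  assumes "\<And>c. \<exists>s. (s, c) \<in> G" and "valid_record G v"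
  shows "\<exists>p w. (\<forall>e\<in>set p. \<not> plain_agent e) \<and> foldl (record_step G) [] w = p @ v"
  using assms(2)
proof (induction "length v + length (filter (\<lambda>e. \<exists>c. e = Exchanged (Agent c)) v)"
    arbitrary: v rule: less_induct)
  case less
  show ?case
  proof (cases v rule: rev_cases)
    case Nil
    then have "foldl (record_step G) [] [] = [] @ v" by simp
    then show ?thesis by (metis empty_iff list.set(1))
  next
    case (snoc v' e)
    have v': "valid_record G v'" and e: "e \<in> record_entries" "\<forall>f\<in>set v'. no_overlook G f e"
      using less.prems by (auto simp: snoc valid_record_append_iff) (auto simp: valid_record_def)
    consider (pa) c where "e = Plain (Agent c)" | (xg) s where "e = Exchanged (Good s)"
      | (xa) c where "e = Exchanged (Agent c)"
      using e(1) by (auto simp: record_entries_def)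
    then show ?thesis
    proof cases
      case pa
      obtain p w where "\<forall>e\<in>set p. \<not> plain_agent e" "foldl (record_step G) [] w = p @ v'"
        using less.hyps[OF _ v'] unfolding snoc pa by auto
      moreover from this have "foldl (record_step G) [] (w @ [Agent c]) = p @ v"
        by (simp add: record_step_Agent snoc pa)
      ultimately show ?thesis by blast
    next
      case xg
      obtain p w where pw: "\<forall>e\<in>set p. \<not> plain_agent e" "foldl (record_step G) [] w = p @ v'"
        using less.hyps[OF _ v'] unfolding snoc xg by auto
      have "record_step G (p @ v') (Good s) = (p @ v') @ [Exchanged (Good s)]"
        using pw(1) e(2) by (intro record_step_lost)
          (auto simp: xg no_overlook_Exchanged_Good plain_agent_def servable_def)
      with pw have "foldl (record_step G) [] (w @ [Good s]) = p @ v"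
        by (simp add: snoc xg)
      with pw show ?thesis by blast
    next
      case xa
      show ?thesis
      proof (cases "\<exists>f\<in>set v'. \<exists>s. f = Exchanged (Good s) \<and> (s, c) \<in> G")
        case True
        then obtain a f b where ab: "v' = a @ f # b" "\<exists>s. f = Exchanged (Good s) \<and> (s, c) \<in> G"
          "\<forall>f\<in>set b. \<not> (\<exists>s. f = Exchanged (Good s) \<and> (s, c) \<in> G)"
          using split_list_last_prop[OF True] by blast
        then obtain s where s: "f = Exchanged (Good s)" "(s, c) \<in> G" by blast
        let ?v = "a @ Plain (Agent c) # b"
        have "\<forall>f\<in>set b. no_overlook G (Plain (Agent c)) f"
          using ab(3) by (auto simp: no_overlook_def)
        then have va: "valid_record G ?v"
          using v' by (auto simp: ab(1) s(1) valid_record_def sorted_wrt_append record_entries_def)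
        obtain p w where pw: "\<forall>e\<in>set p. \<not> plain_agent e" "foldl (record_step G) [] w = p @ ?v"
          using less.hyps[OF _ va] unfolding snoc xa ab(1) s(1) by auto
        \<comment> \<open>By validity of \<open>v'\<close> nothing in \<open>a\<close> is servable
          by \<open>s\<close>, and \<open>p\<close> contains no plain agent; so a further good
          \<open>s\<close> takes exactly the restored agent.\<close>
        have "\<forall>f\<in>set a. \<not> servable G s f"
          using v' by (auto simp: ab(1) s(1) valid_record_def sorted_wrt_append
              no_overlook_Exchanged_Good)
        then have "record_step G ((p @ a) @ Plain (Agent c) # b) (Good s) =
            (p @ a) @ Exchanged (Good s) # b @ [Exchanged (Agent c)]"
          using pw(1) s(2) by (intro record_step_match) (auto simp: plain_agent_def servable_def)
        then have "foldl (record_step G) [] (w @ [Good s]) = p @ v"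
          by (simp add: pw(2) snoc xa ab(1) s(1))
        with pw show ?thesis by blast
      next
        case False
        let ?v = "Plain (Agent c) # v'"
        obtain s where s: "(s, c) \<in> G" using assms(1) by blast
        have "\<forall>f\<in>set v'. no_overlook G (Plain (Agent c)) f"
          using False by (auto simp: no_overlook_def)
        then have va: "valid_record G ?v"
          using v' by (auto simp: valid_record_def record_entries_def)
        obtain p w where pw: "\<forall>e\<in>set p. \<not> plain_agent e" "foldl (record_step G) [] w = p @ ?v"
          using less.hyps[OF _ va] unfolding snoc xa by auto
        have "record_step G (p @ Plain (Agent c) # v') (Good s) =
            p @ Exchanged (Good s) # v' @ [Exchanged (Agent c)]"
          using pw(1) s by (intro record_step_match) (auto simp: plain_agent_def servable_def)
        then have "foldl (record_step G) [] (w @ [Good s]) = (p @ [Exchanged (Good s)]) @ v"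
          by (simp add: pw(2) snoc xa)
        moreover have "\<forall>e\<in>set (p @ [Exchanged (Good s)]). \<not> plain_agent e"
          using pw(1) by (auto simp: plain_agent_def)
        ultimately show ?thesis by blast
      qed
    qed
  qed
qed

definition trim_start :: "('c, 's) entry list \<Rightarrow> ('c, 's) entry list" where
  "trim_start v = dropWhile (\<lambda>e. \<not> plain_agent e) v"

lemma trim_start_append: "\<forall>e\<in>set p. \<not> plain_agent e \<Longrightarrow> trim_start (p @ v) = trim_start v"
  by (simp add: trim_start_def dropWhile_append)

lemma valid_record_trim_start:
  assumes "valid_record G v"
  shows "valid_record G (trim_start v)"
proof -
  have "valid_record G (takeWhile (\<lambda>e. \<not> plain_agent e) v @ trim_start v)"
    using assms by (simp add: trim_start_def)
  then show ?thesis by (simp only: valid_record_append_iff)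
qed

section \<open>Records of the future: states of the form \<open>W\<close>\<close>

fun old_queue :: "('s \<times> 'c) set \<Rightarrow> 'c list \<Rightarrow> ('c, 's) item list \<Rightarrow> 'c list" where
  "old_queue G q [] = q"
| "old_queue G q (Agent c # v) = old_queue G q v"
| "old_queue G q (Good s # v) = old_queue G (remove_first (\<lambda>c. (s, c) \<in> G) q) v"

text \<open>Agents arriving during \<open>v\<close> stand behind all of \<open>q\<close> and never
  affect which member of \<open>q\<close> a good takes. They are therefore recorded but not queued,
  and a good that suits nobody in \<open>q\<close> stays plain even if a newer agent gets
  it.\<close>

fun old_entries :: "('s \<times> 'c) set \<Rightarrow> 'c list \<Rightarrow> ('c, 's) item list \<Rightarrow> ('c, 's) entry list" where
  "old_entries G q [] = []"
| "old_entries G q (Agent c # v) = Plain (Agent c) # old_entries G q v"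
| "old_entries G q (Good s # v) =
    (case find (\<lambda>c. (s, c) \<in> G) q of
       None \<Rightarrow> Plain (Good s)
     | Some c \<Rightarrow> Exchanged (Agent c))
    # old_entries G (remove_first (\<lambda>c. (s, c) \<in> G) q) v"

definition exchanged_agent :: "('c, 's) entry \<Rightarrow> bool" where
  "exchanged_agent e \<longleftrightarrow> (\<exists>c. e = Exchanged (Agent c))"

definition trim_end :: "('c, 's) entry list \<Rightarrow> ('c, 's) entry list" where
  "trim_end v = rev (dropWhile (\<lambda>e. \<not> exchanged_agent e) (rev v))"

definition no_early :: "('s \<times> 'c) set \<Rightarrow> ('c, 's) entry \<Rightarrow> ('c, 's) entry \<Rightarrow> bool" where
  "no_early G e f \<longleftrightarrow> (\<forall>c s. e = Plain (Good s) \<and> f = Exchanged (Agent c) \<longrightarrow> (s, c) \<notin> G)"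

definition old_record_entries :: "('c, 's) entry set" where
  "old_record_entries =
    {e. (\<exists>c. e = Plain (Agent c)) \<or> (\<exists>c. e = Exchanged (Agent c)) \<or> (\<exists>s. e = Plain (Good s))}"

definition valid_old_record :: "('s \<times> 'c) set \<Rightarrow> ('c, 's) entry list \<Rightarrow> bool" where
  "valid_old_record G w \<longleftrightarrow> sorted_wrt (no_early G) w \<and> set w \<subseteq> old_record_entries"

lemma exchanged_in_old_entries: "Exchanged (Agent c) \<in> set (old_entries G q v) \<Longrightarrow> c \<in> set q"
proof (induction G q v rule: old_entries.induct)
  case (3 G q s v)
  then show ?case
    using set_remove_first_subset[of "\<lambda>c. (s, c) \<in> G" q]
    by (auto split: option.splits simp: find_Some_iff)
qed auto

text \<open>A good left plain is incompatible with everybody remaining in \<open>q\<close>, and each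
  exchanged agent further on comes from that remaining queue.\<close>

lemma valid_old_entries: "valid_old_record G (old_entries G q v)"
proof (induction G q v rule: old_entries.induct)
  case (3 G q s v)
  show ?case
  proof (cases "find (\<lambda>c. (s, c) \<in> G) q")
    case None
    then have "\<forall>c\<in>set q. (s, c) \<notin> G"
      by (auto simp: find_None_iff)
    then show ?thesis
      using 3 None
      by (auto simp: valid_old_record_def no_early_def old_record_entries_def remove_first_none
          dest: exchanged_in_old_entries)
  next
    case (Some c)
    then show ?thesis
      using 3 by (auto simp: valid_old_record_def no_early_def old_record_entries_def)
  qed
qed (auto simp: valid_old_record_def no_early_def old_record_entries_def)

lemma valid_trim_end:
  assumes "valid_old_record G w"
  shows "valid_old_record G (trim_end w)"
proof -
  have "trim_end w @ rev (takeWhile (\<lambda>e. \<not> exchanged_agent e) (rev w)) = w"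
    unfolding trim_end_def rev_append[symmetric] takeWhile_dropWhile_id by simp
  then have "valid_old_record G (trim_end w @ rev (takeWhile (\<lambda>e. \<not> exchanged_agent e) (rev w)))"
    using assms by simp
  then show ?thesis
    unfolding valid_old_record_def sorted_wrt_append set_append by blast
qed

lemma old_entries_surj:
  fixes G :: "('s \<times> 'c) set"
  assumes "\<And>c. \<exists>s. (s, c) \<in> G" and "valid_old_record G w"
  shows "\<exists>q v. old_entries G q v = w \<and> old_queue G q v = []"
proof -
  \<comment> \<open>The word is built from its end. The additional clause confines \<open>q\<close>
    to types exchanged later, so validity makes a plain good put in front incompatible with all of
    \<open>q\<close>. For an exchanged agent, its type becomes the head of \<open>q\<close>, where
    any compatible good takes it.\<close>
  have "\<exists>q v. old_entries G q v = w \<and> old_queue G q v = [] \<and>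
      (\<forall>c\<in>set q. Exchanged (Agent c) \<in> set w)"
    using assms(2)
  proof (induction w)
    case Nil
    have "old_entries G [] [] = [] \<and> old_queue G [] [] = []" by simp
    then show ?case by fastforce
  next
    case (Cons e w)
    then obtain q v where qv: "old_entries G q v = w" "old_queue G q v = []"
        "\<forall>c\<in>set q. Exchanged (Agent c) \<in> set w"
      by (auto simp: valid_old_record_def)
    consider (pa) c where "e = Plain (Agent c)" | (pg) s where "e = Plain (Good s)"
      | (xa) c where "e = Exchanged (Agent c)"
      using Cons.prems by (auto simp: valid_old_record_def old_record_entries_def)
    then show ?case
    proof cases
      case pa
      then show ?thesis
        using qv by (intro exI[of _ q] exI[of _ "Agent c # v"]) auto
    next
      case pg
      then have "\<forall>c\<in>set q. (s, c) \<notin> G"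
        using Cons.prems qv(3) by (auto simp: valid_old_record_def no_early_def)
      then have "find (\<lambda>c. (s, c) \<in> G) q = None" "remove_first (\<lambda>c. (s, c) \<in> G) q = q"
        by (auto simp: find_None_iff remove_first_none)
      then show ?thesis
        using qv pg by (intro exI[of _ q] exI[of _ "Good s # v"]) auto
    next
      case xa
      obtain s where "(s, c) \<in> G" using assms(1) by blast
      then show ?thesis
        using qv xa by (intro exI[of _ "c # q"] exI[of _ "Good s # v"]) auto
    qed
  qed
  then show ?thesis by blast
qed

section \<open>Regenerations and waiting agents\<close>

definition queue_from :: "('s \<times> 'c) set \<Rightarrow> (int \<Rightarrow> ('c, 's) item) \<Rightarrow> int \<Rightarrow> int \<Rightarrow> 'c list" where
  "queue_from G x k n = foldl (serve G) [] (map x [k+1..n])"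

text \<open>
  As \<open>queue_from G x k N\<close> increases when \<open>k\<close> decreases, this is emptiness of the limiting stationary
  queue (Loynes).
\<close>

definition empty_at :: "('s \<times> 'c) set \<Rightarrow> (int \<Rightarrow> ('c, 's) item) \<Rightarrow> int \<Rightarrow> bool" where
  "empty_at G x N \<longleftrightarrow> (\<forall>k\<le>N. queue_from G x k N = [])"

definition regenerative :: "('s \<times> 'c) set \<Rightarrow> (int \<Rightarrow> ('c, 's) item) \<Rightarrow> bool" where
  "regenerative G x \<longleftrightarrow> (\<forall>K. \<exists>N\<le>K. empty_at G x N) \<and> (\<forall>K. \<exists>N\<ge>K. empty_at G x N)"

section \<open>Positions of waiting agents, and their agreement with the queue of types\<close>

definition first_match ::
  "('s \<times> 'c) set \<Rightarrow> (int \<Rightarrow> ('c, 's) item) \<Rightarrow> int set \<Rightarrow> int \<Rightarrow> int \<Rightarrow> bool" where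
  "first_match G x S n m \<longleftrightarrow> m \<in> S \<and> (\<exists>s c. x n = Good s \<and> x m = Agent c \<and> (s, c) \<in> G \<and>
     (\<forall>k\<in>S. k < m \<longrightarrow> (\<forall>c'. x k = Agent c' \<longrightarrow> (s, c') \<notin> G)))"

text \<open>The match is looked up in \<open>S\<close>, the agents waiting before \<open>n\<close>.
  Positions are tracked because the pairs of a matching consist of them, while a queue of types
  suffices for emptiness and for the product form.\<close>

definition wait_step ::
  "('s \<times> 'c) set \<Rightarrow> (int \<Rightarrow> ('c, 's) item) \<Rightarrow> int set \<Rightarrow> int \<Rightarrow> int set" where
  "wait_step G x S n =
    {m. (m \<in> S \<or> m = n \<and> (\<exists>c. x n = Agent c)) \<and> \<not> first_match G x S n m}"

definition wait_from :: "('s \<times> 'c) set \<Rightarrow> (int \<Rightarrow> ('c, 's) item) \<Rightarrow> int \<Rightarrow> int \<Rightarrow> int set" where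
  "wait_from G x k n = foldl (wait_step G x) {} [k+1..n]"

lemma upto_snoc: "k \<le> n \<Longrightarrow> [k + 1..n + 1] = [k + 1..n] @ [n + 1]" for k n :: int
  using upto_rec2[of "k + 1" "n + 1"] by simp

lemma wait_from_same [simp]: "wait_from G x k k = {}"
  by (simp add: wait_from_def)

lemma wait_from_step: "k \<le> n \<Longrightarrow> wait_from G x k (n + 1) = wait_step G x (wait_from G x k n) (n + 1)"
  by (simp add: wait_from_def upto_snoc)

lemma wait_from_restart:
  assumes "wait_from G x k j = {}" "k \<le> j" "j \<le> n"
  shows "wait_from G x k n = wait_from G x j n"
proof -
  have "[k+1..n] = [k+1..j] @ [j+1..n]"
    using upto_split1[of "k+1" "j+1" n] assms by (cases "j = n") auto
  with assms(1) show ?thesis by (simp add: wait_from_def)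
qed

lemma queue_from_same [simp]: "queue_from G x k k = []"
  by (simp add: queue_from_def)

lemma queue_from_step: "k \<le> n \<Longrightarrow> queue_from G x k (n + 1) = serve G (queue_from G x k n) (x (n + 1))"
  by (simp add: queue_from_def upto_snoc)

definition lists_waiting :: "(int \<Rightarrow> ('c, 's) item) \<Rightarrow> int list \<Rightarrow> 'c list \<Rightarrow> int set \<Rightarrow> bool" where
  "lists_waiting x ps q S \<longleftrightarrow> sorted_wrt (<) ps \<and> set ps = S \<and> map x ps = map Agent q"

lemma lists_waiting_empty_iff: "lists_waiting x ps q S \<Longrightarrow> q = [] \<longleftrightarrow> S = {}"
  by (auto simp: lists_waiting_def)

lemma lists_waiting_snoc:
  assumes "lists_waiting x ps q S" "\<forall>p\<in>S. p < n" "x n = Agent c"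
  shows "lists_waiting x (ps @ [n]) (q @ [c]) (insert n S)"
  using assms by (auto simp: lists_waiting_def sorted_wrt_append)

lemma lists_waiting_remove_first:
  assumes "lists_waiting x ps q S"
  shows "\<exists>ps'. lists_waiting x ps' (remove_first (\<lambda>c. (s, c) \<in> G) q)
    (S - {m \<in> S. (\<exists>c. x m = Agent c \<and> (s, c) \<in> G) \<and>
       (\<forall>k\<in>S. k < m \<longrightarrow> \<not> (\<exists>c. x k = Agent c \<and> (s, c) \<in> G))})"
proof -
  let ?Q = "\<lambda>i. \<exists>c. i = Agent c \<and> (s, c) \<in> G"
  have "map x (remove_first (\<lambda>m. ?Q (x m)) ps) = remove_first ?Q (map Agent q)"
    using assms map_remove_first[of x ?Q ps] by (simp add: lists_waiting_def)
  also have "\<dots> = map Agent (remove_first (\<lambda>c. (s, c) \<in> G) q)"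
    using map_remove_first[of Agent ?Q q, symmetric] by simp
  finally have "map x (remove_first (\<lambda>m. ?Q (x m)) ps) = map Agent (remove_first (\<lambda>c. (s, c) \<in> G) q)" .
  then show ?thesis
    using assms sorted_remove_first[of ps "\<lambda>m. ?Q (x m)"]
    unfolding lists_waiting_def by (intro exI[of _ "remove_first (\<lambda>m. ?Q (x m)) ps"]) auto
qed

lemma lists_waiting_find:
  assumes "lists_waiting x ps q S"
  shows "find (\<lambda>c. (s, c) \<in> G) q = Some c \<Longrightarrow>
      \<exists>m\<in>S. x m = Agent c \<and> (s, c) \<in> G \<and>
        (\<forall>k\<in>S. k < m \<longrightarrow> (\<forall>c'. x k = Agent c' \<longrightarrow> (s, c') \<notin> G))"
    and "find (\<lambda>c. (s, c) \<in> G) q = None \<Longrightarrow> m \<in> S \<Longrightarrow> x m = Agent c \<Longrightarrow> (s, c) \<notin> G"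
proof -
  have ps: "sorted_wrt (<) ps" "set ps = S" "map x ps = map Agent q"
    using assms by (auto simp: lists_waiting_def)
  { assume "find (\<lambda>c. (s, c) \<in> G) q = Some c"
    then obtain i where i: "i < length q" "(s, q ! i) \<in> G" "c = q ! i" "\<forall>j<i. (s, q ! j) \<notin> G"
      unfolding find_Some_iff by blast
    have len: "length ps = length q" using ps(3) by (rule map_eq_imp_length_eq)
    have x: "x (ps ! j) = Agent (q ! j)" if "j < length q" for j
      using that len arg_cong[OF ps(3), of "\<lambda>l. l ! j"] by simp
    have "\<forall>k\<in>S. k < ps ! i \<longrightarrow> (\<forall>c'. x k = Agent c' \<longrightarrow> (s, c') \<notin> G)"
    proof safe
      fix k c' assume k: "k \<in> S" "k < ps ! i" "x k = Agent c'" "(s, c') \<in> G"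
      then obtain j where j: "j < length ps" "k = ps ! j"
        using ps(2) by (metis in_set_conv_nth)
      have "j < i"
      proof (rule ccontr)
        assume "\<not> j < i"
        then have "ps ! i \<le> ps ! j"
          using sorted_wrt_nth_less[OF ps(1), of i j] j(1) by (cases "i = j") auto
        with k(2) j(2) show False by simp
      qed
      then have "(s, q ! j) \<notin> G" "j < length q" using i by auto
      then show False using x[of j] k(3,4) unfolding j(2) by simp
    qed
    moreover have "ps ! i \<in> S" using i(1) len ps(2) nth_mem by metis
    ultimately show "\<exists>m\<in>S. x m = Agent c \<and> (s, c) \<in> G \<and>
        (\<forall>k\<in>S. k < m \<longrightarrow> (\<forall>c'. x k = Agent c' \<longrightarrow> (s, c') \<notin> G))"
      using i(2,3) x[OF i(1)] by blast
  next
    assume none: "find (\<lambda>c. (s, c) \<in> G) q = None" and m: "m \<in> S" "x m = Agent c"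
    have "x m \<in> set (map x ps)" using m(1) ps(2) by simp
    then have "c \<in> set q" unfolding ps(3) m(2) by auto
    then show "(s, c) \<notin> G" using none by (auto simp: find_None_iff)
  }
qed

lemma wait_step_Agent:
  assumes "x n = Agent c"
  shows "wait_step G x S n = insert n S"
  using assms by (auto simp: wait_step_def first_match_def)

lemma wait_step_Good:
  assumes "x n = Good s"
  shows "wait_step G x S n = S - {m \<in> S. (\<exists>c. x m = Agent c \<and> (s, c) \<in> G) \<and>
       (\<forall>k\<in>S. k < m \<longrightarrow> \<not> (\<exists>c. x k = Agent c \<and> (s, c) \<in> G))}"
  using assms by (auto simp: wait_step_def first_match_def)

lemma wait_from_lists:
  assumes "k \<le> n"
  shows "(\<exists>ps. lists_waiting x ps (queue_from G x k n) (wait_from G x k n)) \<and>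
    wait_from G x k n \<subseteq> {k<..n}"
  using assms
proof (induction n rule: int_ge_induct)
  case base
  then show ?case by (auto simp: lists_waiting_def)
next
  case (step n)
  then obtain ps where ps: "lists_waiting x ps (queue_from G x k n) (wait_from G x k n)"
    and sub: "wait_from G x k n \<subseteq> {k<..n}" by blast
  show ?case
  proof (cases "x (n + 1)")
    case (Agent c)
    then show ?thesis
      using lists_waiting_snoc[OF ps, of "n + 1" c] sub step.hyps
      by (fastforce simp: queue_from_step wait_from_step wait_step_Agent serve_def)
  next
    case (Good s)
    then show ?thesis
      using lists_waiting_remove_first[OF ps, of s G] sub step.hyps
      by (auto simp: queue_from_step wait_from_step wait_step_Good serve_def)
  qed
qed

lemma wait_from_empty_iff: "k \<le> n \<Longrightarrow> wait_from G x k n = {} \<longleftrightarrow> queue_from G x k n = []"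
  using wait_from_lists lists_waiting_empty_iff by metis

lemma wait_from_empty_at: "empty_at G x N \<Longrightarrow> k \<le> N \<Longrightarrow> wait_from G x k N = {}"
  by (simp add: wait_from_empty_iff empty_at_def)

section \<open>Existence and uniqueness of the matching\<close>

text \<open>The definition quantifies over all earlier agents, but those taken before
  \<open>n\<close> fulfil its condition trivially, which leaves the ones waiting at
  \<open>n - 1\<close>. A condition in which the matching refers to itself thus becomes a recursion
  in time.\<close>

lemma fcfs_iff_first_match:
  assumes "directed_fcfs_matching G x A"
  shows "(m, n) \<in> A \<longleftrightarrow> first_match G x (waiting x A (n - 1)) n m"
proof
  assume mn: "(m, n) \<in> A"
  then obtain c s where cs: "x m = Agent c" "x n = Good s"
    using assms unfolding directed_fcfs_matching_def by blast
  then have "m < n" "(s, c) \<in> G"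
    "\<forall>k<m. \<forall>c'. x k = Agent c' \<and> (s, c') \<in> G \<longrightarrow> (\<exists>l<n. (k, l) \<in> A)"
    "\<not> (\<exists>l<n. (m, l) \<in> A)"
    using assms mn unfolding directed_fcfs_matching_def by blast+
  then show "first_match G x (waiting x A (n - 1)) n m"
    using cs by (auto simp: first_match_def waiting_def)
next
  assume fm: "first_match G x (waiting x A (n - 1)) n m"
  then obtain c s where cs: "x m = Agent c" "x n = Good s" "(s, c) \<in> G"
    and m: "m < n" "\<not> (\<exists>l<n. (m, l) \<in> A)"
    and first: "\<forall>k\<in>waiting x A (n - 1). k < m \<longrightarrow> (\<forall>c'. x k = Agent c' \<longrightarrow> (s, c') \<notin> G)"
    by (auto simp: first_match_def waiting_def)
  have "\<exists>l<n. (k, l) \<in> A" if "k < m" "x k = Agent c'" "(s, c') \<in> G" for k c'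
  proof (rule ccontr)
    assume "\<not> (\<exists>l<n. (k, l) \<in> A)"
    then have "k \<in> waiting x A (n - 1)"
      using that m by (auto simp: waiting_def)
    with first that show False by blast
  qed
  then show "(m, n) \<in> A"
    using assms cs m unfolding directed_fcfs_matching_def by blast
qed

lemma fcfs_pairD:
  assumes "directed_fcfs_matching G x A" "(m, n) \<in> A"
  shows "m < n" "\<exists>c. x m = Agent c" "\<exists>s. x n = Good s" "m \<in> waiting x A (n - 1)"
  using assms(2) unfolding fcfs_iff_first_match[OF assms(1)]
  by (auto simp: first_match_def waiting_def)

lemma waiting_step:
  assumes "directed_fcfs_matching G x A"
  shows "waiting x A n = wait_step G x (waiting x A (n - 1)) n"
proof -
  have "m \<in> waiting x A n \<longleftrightarrow>
      (m \<in> waiting x A (n - 1) \<or> m = n \<and> (\<exists>c. x n = Agent c)) \<and> (m, n) \<notin> A" for m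
  proof -
    have "l \<le> n \<longleftrightarrow> l \<le> n - 1 \<or> l = n" for l by auto
    then have "(\<exists>l\<le>n. (m, l) \<in> A) \<longleftrightarrow> (\<exists>l\<le>n - 1. (m, l) \<in> A) \<or> (m, n) \<in> A"
      by blast
    moreover have "\<not> (\<exists>l\<le>n - 1. (n, l) \<in> A)"
      using fcfs_pairD(1)[OF assms] by fastforce
    ultimately show ?thesis
      by (cases "m = n") (auto simp: waiting_def)
  qed
  then show ?thesis
    unfolding wait_step_def fcfs_iff_first_match[OF assms, symmetric] by auto
qed

lemma waiting_eq_wait_from:
  assumes "directed_fcfs_matching G x A" "waiting x A k = {}" "k \<le> n"
  shows "waiting x A n = wait_from G x k n"
  using assms(3)
proof (induction n rule: int_ge_induct)
  case (step n)
  then show ?case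
    using waiting_step[OF assms(1), of "n + 1"] by (simp add: wait_from_step)
qed (use assms in simp)

section \<open>The matching built from regenerations\<close>

definition regen_wait :: "('s \<times> 'c) set \<Rightarrow> (int \<Rightarrow> ('c, 's) item) \<Rightarrow> int \<Rightarrow> int set" where
  "regen_wait G x n = wait_from G x (SOME k. k \<le> n \<and> empty_at G x k) n"

definition regen_matching :: "('s \<times> 'c) set \<Rightarrow> (int \<Rightarrow> ('c, 's) item) \<Rightarrow> (int \<times> int) set" where
  "regen_matching G x = {(m, n). first_match G x (regen_wait G x (n - 1)) n m}"

text \<open>Of two regenerations, the later one is also an empty time of the process started at the
  earlier one, which restarts there. Hence the choice made by \<open>SOME\<close> is
  immaterial.\<close>

lemma regen_wait_eq:
  assumes "empty_at G x k" "k \<le> n"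
  shows "regen_wait G x n = wait_from G x k n"
proof -
  define j where "j = (SOME k. k \<le> n \<and> empty_at G x k)"
  have "j \<le> n \<and> empty_at G x j"
    unfolding j_def by (rule someI[of _ k]) (use assms in simp)
  then have "wait_from G x j n = wait_from G x k n"
    using assms wait_from_restart[of G x j k n] wait_from_restart[of G x k j n]
      wait_from_empty_at by (metis nle_le)
  then show ?thesis by (simp add: regen_wait_def j_def)
qed

lemma regenerative_early: "regenerative G x \<Longrightarrow> \<exists>N\<le>K. empty_at G x N"
  and regenerative_late: "regenerative G x \<Longrightarrow> \<exists>N\<ge>K. empty_at G x N"
  by (auto simp: regenerative_def)

lemma regen_wait_step:
  assumes "regenerative G x"
  shows "regen_wait G x n = wait_step G x (regen_wait G x (n - 1)) n"
proof -
  obtain k where "k \<le> n - 1" "empty_at G x k"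
    using regenerative_early[OF assms] by blast
  then show ?thesis
    using wait_from_step[of k "n - 1" G x] by (simp add: regen_wait_eq)
qed

lemma regen_wait_le:
  assumes "regenerative G x" "m \<in> regen_wait G x n"
  shows "m \<le> n" "\<exists>c. x m = Agent c"
proof -
  obtain k where k: "k \<le> n" "empty_at G x k"
    using regenerative_early[OF assms(1)] by blast
  then have m: "m \<in> wait_from G x k n"
    using assms(2) by (simp add: regen_wait_eq)
  obtain ps where ps: "lists_waiting x ps (queue_from G x k n) (wait_from G x k n)"
      "wait_from G x k n \<subseteq> {k<..n}"
    using wait_from_lists[OF k(1)] by blast
  show "m \<le> n" using ps m by auto
  have "x m \<in> x ` set ps" using ps m by (auto simp: lists_waiting_def)
  also have "\<dots> = Agent ` set (queue_from G x k n)"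
    using ps(1) unfolding lists_waiting_def by (metis image_set)
  finally show "\<exists>c. x m = Agent c" by auto
qed

text \<open>Closes a circle: the matching was defined from \<open>regen_wait\<close>, and its own
  waiting agents must turn out to be the same set. The induction needs a starting point, so it first
  treats positions beyond a fixed regeneration \<open>k\<close>.\<close>

lemma waiting_regen_matching:
  assumes "regenerative G x"
  shows "waiting x (regen_matching G x) n = regen_wait G x n"
proof -
  let ?A = "regen_matching G x"
  have less: "m < l" if "(m, l) \<in> ?A" for m l
    using that regen_wait_le(1)[OF assms, of m "l - 1"]
    by (auto simp: regen_matching_def first_match_def)
  have eq: "regen_wait G x n = {m. k < m \<and> m \<le> n \<and> (\<exists>c. x m = Agent c) \<and> \<not> (\<exists>l\<le>n. (m, l) \<in> ?A)}"
    if k: "empty_at G x k" "k \<le> n" for k n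
    using k(2)
  proof (induction n rule: int_ge_induct)
    case base
    then show ?case using k by (auto simp: regen_wait_eq)
  next
    case (step n)
    have l: "(\<exists>l\<le>n + 1. (m, l) \<in> ?A) \<longleftrightarrow> (\<exists>l\<le>n. (m, l) \<in> ?A) \<or> (m, n + 1) \<in> ?A" for m
    proof -
      have "l \<le> n + 1 \<longleftrightarrow> l \<le> n \<or> l = n + 1" for l by auto
      then show ?thesis by blast
    qed
    have "regen_wait G x (n + 1) = {m. (m \<in> regen_wait G x n \<or> m = n + 1 \<and> (\<exists>c. x m = Agent c)) \<and>
        (m, n + 1) \<notin> ?A}"
      using regen_wait_step[OF assms, of "n + 1"]
      by (auto simp: wait_step_def regen_matching_def)
    also have "\<dots> = {m. k < m \<and> m \<le> n + 1 \<and> (\<exists>c. x m = Agent c) \<and> \<not> (\<exists>l\<le>n + 1. (m, l) \<in> ?A)}"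
    proof (intro Collect_cong)
      fix m
      have "(m, l) \<notin> ?A" if "m = n + 1" "l \<le> n" for l
        using less[of m l] that by auto
      then show "(m \<in> regen_wait G x n \<or> m = n + 1 \<and> (\<exists>c. x m = Agent c)) \<and> (m, n + 1) \<notin> ?A \<longleftrightarrow>
          k < m \<and> m \<le> n + 1 \<and> (\<exists>c. x m = Agent c) \<and> \<not> (\<exists>l\<le>n + 1. (m, l) \<in> ?A)"
        unfolding l step.IH using step.hyps by (cases "m = n + 1") auto
    qed
    finally show ?case .
  qed
  show ?thesis
  proof (intro set_eqI iffI)
    fix m assume m: "m \<in> waiting x ?A n"
    \<comment> \<open>The equation only speaks of positions beyond \<open>k\<close>, so the
      regeneration has to precede \<open>m\<close>.\<close>
    obtain k where k: "k \<le> m - 1" "empty_at G x k"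
      using regenerative_early[OF assms] by blast
    then show "m \<in> regen_wait G x n"
      using m eq[OF k(2), of n] by (auto simp: waiting_def)
  next
    fix m assume m: "m \<in> regen_wait G x n"
    obtain k where k: "k \<le> n" "empty_at G x k"
      using regenerative_early[OF assms] by blast
    then show "m \<in> waiting x ?A n"
      using m eq[OF k(2), of n] by (auto simp: waiting_def)
  qed
qed

lemma regen_matching_iff:
  assumes "regenerative G x"
  shows "(m, n) \<in> regen_matching G x \<longleftrightarrow>
    first_match G x (waiting x (regen_matching G x) (n - 1)) n m"
  unfolding waiting_regen_matching[OF assms] by (simp add: regen_matching_def)

lemma directed_fcfs_regen_matching:
  assumes "regenerative G x"
  shows "directed_fcfs_matching G x (regen_matching G x)"
proof -
  let ?A = "regen_matching G x"
  note iff = regen_matching_iff[OF assms]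
  have "single_valued ?A"
  proof (rule single_valuedI)
    fix m n n' assume "(m, n) \<in> ?A" "(m, n') \<in> ?A"
    then have "m \<in> waiting x ?A (n - 1)" "m \<in> waiting x ?A (n' - 1)"
      unfolding iff[of m n] iff[of m n'] by (auto simp: first_match_def)
    then have "\<not> n \<le> n' - 1" "\<not> n' \<le> n - 1"
      using \<open>(m, n) \<in> ?A\<close> \<open>(m, n') \<in> ?A\<close> unfolding waiting_def by blast+
    then show "n = n'" by simp
  qed
  moreover have "single_valued (?A\<inverse>)"
  proof (rule single_valuedI)
    fix n m m' assume "(n, m) \<in> ?A\<inverse>" "(n, m') \<in> ?A\<inverse>"
    then have "first_match G x (regen_wait G x (n - 1)) n m"
      "first_match G x (regen_wait G x (n - 1)) n m'"
      by (simp_all add: regen_matching_def)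
    then have "\<not> m < m'" "\<not> m' < m"
      unfolding first_match_def by fastforce+
    then show "m = m'" by simp
  qed
  moreover have "(m, n) \<in> ?A \<longleftrightarrow> m < n \<and> (s, c) \<in> G \<and>
        (\<forall>k<m. \<forall>c'. x k = Agent c' \<and> (s, c') \<in> G \<longrightarrow> (\<exists>l<n. (k, l) \<in> ?A)) \<and>
        \<not> (\<exists>l<n. (m, l) \<in> ?A)" if "x m = Agent c" "x n = Good s" for m n c s
  proof -
    have w: "k \<in> waiting x ?A (n - 1) \<longleftrightarrow>
        k < n \<and> (\<exists>c. x k = Agent c) \<and> \<not> (\<exists>l<n. (k, l) \<in> ?A)" for k
      by (simp add: waiting_def)
    have "first_match G x (waiting x ?A (n - 1)) n m \<longleftrightarrow>
        m \<in> waiting x ?A (n - 1) \<and> (s, c) \<in> G \<and>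
        (\<forall>k c'. k \<in> waiting x ?A (n - 1) \<and> k < m \<and> x k = Agent c' \<longrightarrow> (s, c') \<notin> G)"
      using that by (auto simp: first_match_def)
    also have "\<dots> \<longleftrightarrow> m < n \<and> (s, c) \<in> G \<and>
        (\<forall>k<m. \<forall>c'. x k = Agent c' \<and> (s, c') \<in> G \<longrightarrow> (\<exists>l<n. (k, l) \<in> ?A)) \<and>
        \<not> (\<exists>l<n. (m, l) \<in> ?A)"
      unfolding w using that(1) by (meson order.strict_trans)
    finally show ?thesis unfolding iff[of m n] .
  qed
  moreover have "\<exists>c s. x m = Agent c \<and> x n = Good s" if "(m, n) \<in> ?A" for m n
    using that by (auto simp: regen_matching_def first_match_def)
  ultimately show ?thesis unfolding directed_fcfs_matching_def by blast
qed

lemma waiting_regen_matching_empty: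
  "regenerative G x \<Longrightarrow> empty_at G x N \<Longrightarrow> waiting x (regen_matching G x) N = {}"
  by (simp add: waiting_regen_matching regen_wait_eq)

lemma the_matching_eq:
  assumes "regenerative G x"
  shows "the_matching G x = regen_matching G x"
  unfolding the_matching_def
proof (rule the_equality)
  let ?A = "regen_matching G x"
  have "all_agents_matched x ?A"
    unfolding all_agents_matched_def
  proof safe
    fix m c assume m: "x m = Agent c"
    obtain N where "m \<le> N" "empty_at G x N" using regenerative_late[OF assms] by blast
    then have "m \<notin> waiting x ?A N" "m \<le> N"
      using waiting_regen_matching_empty[OF assms] by auto
    then show "\<exists>n. (m, n) \<in> ?A" using m by (auto simp: waiting_def)
  qed
  then show "directed_fcfs_matching G x ?A \<and> all_agents_matched x ?A \<and>
      (\<forall>N. \<exists>N'\<le>N. waiting x ?A N' = {})"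
    using directed_fcfs_regen_matching[OF assms] waiting_regen_matching_empty[OF assms]
      regenerative_early[OF assms] by blast
next
  fix A
  assume A: "directed_fcfs_matching G x A \<and> all_agents_matched x A \<and>
    (\<forall>N. \<exists>N'\<le>N. waiting x A N' = {})"
  have "waiting x A n = regen_wait G x n" for n
  proof -
    obtain N where N: "N \<le> n" "empty_at G x N" using regenerative_early[OF assms] by blast
    \<comment> \<open>The competitor is known to be empty at early times, but not at regenerations.
      From such a time \<open>k\<close> on it follows \<open>wait_from\<close>, and as
      \<open>empty_at\<close> covers the start \<open>k\<close>, it is empty at \<open>N\<close> as
      well.\<close>
    obtain k where k: "k \<le> N" "waiting x A k = {}" using A by blast
    have "waiting x A n = wait_from G x k n"
      using A k N by (intro waiting_eq_wait_from) auto
    also have "\<dots> = wait_from G x N n"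
      by (rule wait_from_restart) (use k N wait_from_empty_at[OF N(2) k(1)] in auto)
    finally show ?thesis using N by (simp add: regen_wait_eq)
  qed
  then show "A = regen_matching G x"
    using A by (auto simp: fcfs_iff_first_match regen_matching_def)
qed

section \<open>The exchanged configurations as functions of a window of the sequence\<close>

lemma exchange_at_agent:
  assumes "directed_fcfs_matching G x A" "B \<subseteq> A" "(p, n) \<in> B"
  shows "exchange x B p = Exchanged (x n)"
proof -
  have "single_valued A" using assms(1) unfolding directed_fcfs_matching_def by blast
  then have "n' = n" if "(p, n') \<in> B" for n'
    using that assms(2,3) unfolding single_valued_def by blast
  then have "(THE n. (p, n) \<in> B) = n"
    using assms(3) by (intro the_equality)
  then show ?thesis using assms(3) by (auto simp: exchange_def)
qed

lemma exchange_at_good: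
  assumes "directed_fcfs_matching G x A" "B \<subseteq> A" "(m, p) \<in> B"
  shows "exchange x B p = Exchanged (x m)"
proof -
  have "single_valued (A\<inverse>)" using assms(1) unfolding directed_fcfs_matching_def by blast
  then have "m' = m" if "(m', p) \<in> B" for m'
    using that assms(2,3) unfolding single_valued_def by blast
  then have "(THE m. (m, p) \<in> B) = m"
    using assms(3) by (intro the_equality)
  moreover have "\<not> (\<exists>n. (p, n) \<in> B)"
  proof
    assume "\<exists>n. (p, n) \<in> B"
    then obtain n where "(p, n) \<in> A" "(m, p) \<in> A" using assms(2,3) by blast
    then show False
      using fcfs_pairD(2)[OF assms(1), of p n] fcfs_pairD(3)[OF assms(1), of m p] by auto
  qed
  ultimately show ?thesis using assms(3) by (auto simp: exchange_def)
qed

lemma exchange_unmatched: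
  "\<not> (\<exists>n. (p, n) \<in> B) \<Longrightarrow> \<not> (\<exists>m. (m, p) \<in> B) \<Longrightarrow> exchange x B p = Plain (x p)"
  by (simp add: exchange_def)

definition record_at ::
  "(int \<Rightarrow> ('c, 's) item) \<Rightarrow> (int \<times> int) set \<Rightarrow> int \<Rightarrow> int \<Rightarrow> ('c, 's) entry" where
  "record_at x A N p = mark_lost (exchange x {(m, n). (m, n) \<in> A \<and> n \<le> N} p)"

text \<open>Allows the waiting agents to be read off the record: \<open>mark_lost\<close> leaves no
  plain good, and every item matched by time \<open>N\<close> is marked as exchanged.\<close>

lemma record_at_plain:
  assumes "directed_fcfs_matching G x A" "p \<le> N"
  shows "record_at x A N p = Plain (Agent c) \<longleftrightarrow> p \<in> waiting x A N \<and> x p = Agent c"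
proof -
  let ?B = "{(m, n). (m, n) \<in> A \<and> n \<le> N}"
  have B: "?B \<subseteq> A" by auto
  have lost: "mark_lost (Plain i) = Plain (Agent c) \<longleftrightarrow> i = Agent c" for i
    by (cases i) auto
  consider (agent) n where "(p, n) \<in> ?B" | (good) m where "(m, p) \<in> ?B"
    | (none) "\<not> (\<exists>n. (p, n) \<in> ?B)" "\<not> (\<exists>m. (m, p) \<in> ?B)" by blast
  then show ?thesis
  proof cases
    case agent
    obtain s where "x n = Good s" using fcfs_pairD(3)[OF assms(1), of p n] agent by auto
    moreover have "p \<notin> waiting x A N" using agent by (auto simp: waiting_def)
    ultimately show ?thesis
      unfolding record_at_def exchange_at_agent[OF assms(1) B agent] by simp
  next
    case good
    obtain s where "x p = Good s" using fcfs_pairD(3)[OF assms(1), of m p] good by auto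
    moreover obtain c' where "x m = Agent c'" using fcfs_pairD(2)[OF assms(1), of m p] good by auto
    ultimately show ?thesis
      unfolding record_at_def exchange_at_good[OF assms(1) B good] by simp
  next
    case none
    then show ?thesis
      using assms(2) unfolding record_at_def exchange_unmatched[OF none] lost
      by (auto simp: waiting_def)
  qed
qed

text \<open>Passing from \<open>N\<close> to \<open>N + 1\<close> adds at most one pair, so only the
  new entry and the one at the partner \<open>m\<close> can change. The partner is the first waiting
  compatible agent, which is the first servable entry of the record.\<close>

lemma record_eq_foldl:
  assumes A: "directed_fcfs_matching G x A" and "waiting x A N0 = {}" and "N0 \<le> N"
  shows "map (record_at x A N) [N0+1..N] = foldl (record_step G) [] (map x [N0+1..N])"
  using assms(3)
proof (induction N rule: int_ge_induct)
  case base
  then show ?case by simp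
next
  case (step N)
  let ?B = "\<lambda>N. {(m, n). (m, n) \<in> A \<and> n \<le> N}"
  have B: "?B n \<subseteq> A" for n by auto
  have fold: "foldl (record_step G) [] (map x [N0+1..N + 1]) =
      record_step G (map (record_at x A N) [N0+1..N]) (x (N + 1))"
    using step by (simp add: upto_snoc)
  have map: "map (record_at x A (N + 1)) [N0+1..N + 1] =
      map (record_at x A (N + 1)) [N0+1..N] @ [record_at x A (N + 1) (N + 1)]"
    using step.hyps by (simp add: upto_snoc)
  have no_later: "\<not> (\<exists>n. (N + 1, n) \<in> ?B (N + 1))"
    using fcfs_pairD(1)[OF A] by fastforce
  have wait: "waiting x A N \<subseteq> {N0<..N}"
    using waiting_eq_wait_from[OF A assms(2) step.hyps] wait_from_lists[OF step.hyps] by blast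
  have le_Suc: "n \<le> N + 1 \<longleftrightarrow> n \<le> N \<or> n = N + 1" for n by auto
  show ?case
  proof (cases "\<exists>m. (m, N + 1) \<in> A")
    case False
    then have "?B (N + 1) = ?B N"
      unfolding le_Suc by auto
    then have "record_at x A (N + 1) = record_at x A N"
      by (simp add: record_at_def fun_eq_iff)
    then have map': "map (record_at x A (N + 1)) [N0+1..N + 1] =
      map (record_at x A N) [N0+1..N] @ [record_at x A (N + 1) (N + 1)]"
      unfolding map by simp
    have "record_at x A (N + 1) (N + 1) = mark_lost (Plain (x (N + 1)))"
      unfolding record_at_def
      by (subst exchange_unmatched[OF no_later]) (use False in auto)
    note map'' = map'[unfolded this]
    show ?thesis
    proof (cases "x (N + 1)")
      case (Agent c)
      then show ?thesis unfolding fold map'' by (simp add: record_step_Agent)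
    next
      case (Good s)
      have "\<not> servable G s (record_at x A N p)" if p: "p \<in> {N0+1..N}" for p
      proof
        assume "servable G s (record_at x A N p)"
        \<comment> \<open>Were some waiting agent compatible, the earliest such one would be matched
          to \<open>N + 1\<close>; the finiteness of the waiting set guarantees that an earliest one
          exists.\<close>
        then have "p \<in> {m \<in> waiting x A N. \<exists>c. x m = Agent c \<and> (s, c) \<in> G}" (is "p \<in> ?S")
          using p record_at_plain[OF A] by (auto simp: servable_def)
        moreover have "finite ?S"
          using wait finite_subset by fastforce
        ultimately have "Min ?S \<in> ?S" "\<forall>k\<in>?S. Min ?S \<le> k"
          using Min_in[of ?S] by auto
        then have "first_match G x (waiting x A N) (N + 1) (Min ?S)"
          using Good unfolding first_match_def by fastforce
        then have "(Min ?S, N + 1) \<in> A"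
          by (simp add: fcfs_iff_first_match[OF A, of _ "N + 1"])
        with False show False by blast
      qed
      then have "record_step G (map (record_at x A N) [N0+1..N]) (Good s) =
          map (record_at x A N) [N0+1..N] @ [Exchanged (Good s)]"
        by (intro record_step_lost) auto
      then show ?thesis unfolding fold map'' Good by simp
    qed
  next
    case True
    then obtain m where m: "(m, N + 1) \<in> A" by blast
    then have fm: "first_match G x (waiting x A N) (N + 1) m"
      using fcfs_iff_first_match[OF A, of m "N + 1"] by simp
    then obtain s c where sc: "x (N + 1) = Good s" "x m = Agent c" "(s, c) \<in> G" "m \<in> waiting x A N"
      and first: "\<forall>k\<in>waiting x A N. k < m \<longrightarrow> (\<forall>c'. x k = Agent c' \<longrightarrow> (s, c') \<notin> G)"
      by (auto simp: first_match_def)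
    have mN: "N0 < m" "m \<le> N" using sc(4) wait by auto
    have split: "[N0+1..N] = [N0+1..m - 1] @ m # [m + 1..N]"
      using upto_split3[of "N0 + 1" m N] mN by simp
    have B': "?B (N + 1) = insert (m, N + 1) (?B N)"
    proof -
      have "single_valued (A\<inverse>)" using A unfolding directed_fcfs_matching_def by blast
      then have "k = m" if "(k, N + 1) \<in> A" for k
        using that m unfolding single_valued_def by blast
      then show ?thesis using m unfolding le_Suc by blast
    qed
    have other: "record_at x A (N + 1) p = record_at x A N p" if "p \<noteq> m" "p \<noteq> N + 1" for p
    proof -
      have "(p, n) \<in> ?B (N + 1) \<longleftrightarrow> (p, n) \<in> ?B N" "(n, p) \<in> ?B (N + 1) \<longleftrightarrow> (n, p) \<in> ?B N" for n
        using that unfolding B' by auto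
      then show ?thesis unfolding record_at_def exchange_def by presburger
    qed
    have "record_at x A N m = Plain (Agent c)"
      using record_at_plain[OF A mN(2)] sc by blast
    then have old: "map (record_at x A N) [N0+1..N] =
        map (record_at x A N) [N0+1..m - 1] @ Plain (Agent c) # map (record_at x A N) [m + 1..N]"
      unfolding split by simp
    have "\<not> servable G s (record_at x A N p)" if "p \<in> {N0+1..m - 1}" for p
      using record_at_plain[OF A, of p N] first mN that by (auto simp: servable_def)
    then have rs: "record_step G (map (record_at x A N) [N0+1..N]) (Good s) =
        map (record_at x A N) [N0+1..m - 1] @ Exchanged (Good s) #
        map (record_at x A N) [m + 1..N] @ [Exchanged (Agent c)]"
      unfolding old using sc(3) by (intro record_step_match) auto
    have mB: "(m, N + 1) \<in> ?B (N + 1)" using m by auto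
    have "record_at x A (N + 1) m = Exchanged (Good s)"
      unfolding record_at_def exchange_at_agent[OF A B mB] sc(1) by simp
    moreover have "record_at x A (N + 1) (N + 1) = Exchanged (Agent c)"
      unfolding record_at_def exchange_at_good[OF A B mB] sc(2) by simp
    moreover have "map (record_at x A (N + 1)) [N0+1..m - 1] = map (record_at x A N) [N0+1..m - 1]"
      "map (record_at x A (N + 1)) [m + 1..N] = map (record_at x A N) [m + 1..N]"
      using mN by (auto intro!: other)
    ultimately show ?thesis
      unfolding fold map sc(1) rs unfolding split by simp
  qed
qed

lemma U_eq_trim_start:
  assumes x: "regenerative G x" and "empty_at G x N0" and "N0 \<le> N"
  shows "U G x N = trim_start (foldl (record_step G) [] (map x [N0+1..N]))"
proof -
  let ?A = "regen_matching G x"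
  note A = directed_fcfs_regen_matching[OF x]
  have N0: "waiting x ?A N0 = {}"
    by (rule waiting_regen_matching_empty) fact+
  have fold: "foldl (record_step G) [] (map x [N0+1..N]) = map (record_at x ?A N) [N0+1..N]"
    by (rule record_eq_foldl[symmetric]) fact+
  have plain: "plain_agent (record_at x ?A N p) \<longleftrightarrow> p \<in> waiting x ?A N" if "p \<le> N" for p
    using record_at_plain[OF A that] by (auto simp: plain_agent_def waiting_def)
  have U: "U G x N = (if waiting x ?A N = {} then []
      else map (record_at x ?A N) [Min (waiting x ?A N)..N])"
    unfolding U_def Let_def the_matching_eq[OF x] record_at_def by simp
  show ?thesis
  proof (cases "waiting x ?A N = {}")
    case True
    have "trim_start (map (record_at x ?A N) [N0+1..N]) = []"
      unfolding trim_start_def dropWhile_eq_Nil_conv using plain True by simp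
    then show ?thesis
      unfolding U fold using True by simp
  next
    case False
    have wait: "waiting x ?A N \<subseteq> {N0<..N}"
      using waiting_eq_wait_from[OF A N0 assms(3)] wait_from_lists[OF assms(3)] by blast
    then have fin: "finite (waiting x ?A N)" by (rule finite_subset) simp
    define m where "m = Min (waiting x ?A N)"
    have m: "m \<in> waiting x ?A N" "\<forall>k\<in>waiting x ?A N. m \<le> k"
      using False fin by (auto simp: m_def)
    have mN: "N0 < m" "m \<le> N" using m wait by auto
    have "[N0+1..N] = [N0+1..m - 1] @ m # [m + 1..N]"
      using upto_split3[of "N0 + 1" m N] mN by simp
    moreover have "\<forall>e\<in>set (map (record_at x ?A N) [N0+1..m - 1]). \<not> plain_agent e"
      using plain m mN by fastforce
    moreover have "plain_agent (record_at x ?A N m)"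
      using plain m mN by blast
    ultimately have "trim_start (map (record_at x ?A N) [N0+1..N]) =
        map (record_at x ?A N) (m # [m + 1..N])"
      by (simp add: trim_start_append) (simp add: trim_start_def)
    then show ?thesis
      unfolding U fold using False mN by (simp add: m_def[symmetric] upto_rec1)
  qed
qed

text \<open>With \<open>N\<close> fixed, the induction peels items off the front, so
  \<open>n\<close> and the queue vary. The waiting set cut off at \<open>N\<close> evolves by
  itself: later agents lie to its right and never precede one of its members.\<close>

lemma old_entries_eq_exchange:
  assumes A: "directed_fcfs_matching G x A"
    and "N \<le> n" and "lists_waiting x ps q (waiting x A n \<inter> {..N})"
  shows "map (exchange x {(m, n). (m, n) \<in> A \<and> m \<le> N}) [n+1..n + int d] =
      old_entries G q (map x [n+1..n + int d]) \<and>
    (\<exists>ps'. lists_waiting x ps' (old_queue G q (map x [n+1..n + int d]))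
      (waiting x A (n + int d) \<inter> {..N}))"
  using assms(2,3)
proof (induction d arbitrary: n ps q)
  case 0
  then show ?case by auto
next
  case (Suc d)
  let ?B = "{(m, n). (m, n) \<in> A \<and> m \<le> N}"
  have B: "?B \<subseteq> A" by auto
  have iv: "[n+1..(n + 1) + int d] = (n + 1) # [(n + 1) + 1..(n + 1) + int d]"
    using upto_rec1[of "n + 1" "(n + 1) + int d"] by simp
  have end': "n + int (Suc d) = (n + 1) + int d" by simp
  have ws: "waiting x A (n + 1) = wait_step G x (waiting x A n) (n + 1)"
    using waiting_step[OF A, of "n + 1"] by simp
  have iff: "(m, n + 1) \<in> A \<longleftrightarrow> first_match G x (waiting x A n) (n + 1) m" for m
    using fcfs_iff_first_match[OF A, of m "n + 1"] by simp
  have no_later: "\<not> (\<exists>l. (n + 1, l) \<in> ?B)" and le: "N \<le> n + 1"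
    using Suc.prems by auto
  show ?case
  proof (cases "x (n + 1)")
    case (Agent c)
    then have "waiting x A (n + 1) \<inter> {..N} = waiting x A n \<inter> {..N}"
      using Suc.prems unfolding ws by (auto simp: wait_step_Agent)
    then have IH: "lists_waiting x ps q (waiting x A (n + 1) \<inter> {..N})"
      using Suc.prems by simp
    have "(m, n + 1) \<notin> ?B" for m
      using fcfs_pairD(3)[OF A, of m "n + 1"] Agent by auto
    then have "exchange x ?B (n + 1) = Plain (Agent c)"
      using exchange_unmatched[OF no_later, of x] Agent by metis
    then show ?thesis
      using Suc.IH[OF le IH]
      unfolding iv end' list.map Agent old_entries.simps old_queue.simps by (simp only: simp_thms)
  next
    case (Good s)
    let ?S = "waiting x A n \<inter> {..N}"
    let ?P = "\<lambda>m. \<exists>c. x m = Agent c \<and> (s, c) \<in> G"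
    have "waiting x A (n + 1) \<inter> {..N} = ?S - {m \<in> ?S. ?P m \<and> (\<forall>k\<in>?S. k < m \<longrightarrow> \<not> ?P k)}"
      unfolding ws wait_step_Good[of x, OF Good] by auto
    then obtain ps' where IH: "lists_waiting x ps' (remove_first (\<lambda>c. (s, c) \<in> G) q)
        (waiting x A (n + 1) \<inter> {..N})"
      using lists_waiting_remove_first[OF Suc.prems(2), of s G] by auto
    have "exchange x ?B (n + 1) = (case find (\<lambda>c. (s, c) \<in> G) q of
        None \<Rightarrow> Plain (Good s) | Some c \<Rightarrow> Exchanged (Agent c))"
    proof (cases "find (\<lambda>c. (s, c) \<in> G) q")
      case None
      then have "\<not> (\<exists>m. (m, n + 1) \<in> ?B)"
        using lists_waiting_find(2)[OF Suc.prems(2) None] Good by (auto simp: iff first_match_def)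
      then show ?thesis
        using exchange_unmatched[OF no_later, of x] None Good by simp
    next
      case (Some c)
      then obtain m where m: "m \<in> ?S" "x m = Agent c" "(s, c) \<in> G"
          "\<forall>k\<in>?S. k < m \<longrightarrow> (\<forall>c'. x k = Agent c' \<longrightarrow> (s, c') \<notin> G)"
        using lists_waiting_find(1)[OF Suc.prems(2) Some] by blast
      then have "(m, n + 1) \<in> ?B"
        using Good by (auto simp: iff first_match_def)
      then show ?thesis
        using exchange_at_good[OF A B] m(2) Some by simp
    qed
    then show ?thesis
      using Suc.IH[OF le IH]
      unfolding iv end' list.map Good old_entries.simps old_queue.simps by (simp only: simp_thms)
  qed
qed

lemma queue_from_lists_waiting:
  assumes x: "regenerative G x" and "empty_at G x N0" and "N0 \<le> N"
  shows "\<exists>ps. lists_waiting x ps (queue_from G x N0 N) (waiting x (regen_matching G x) N \<inter> {..N})"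
proof -
  let ?A = "regen_matching G x"
  have "waiting x ?A N \<inter> {..N} = wait_from G x N0 N"
    using waiting_eq_wait_from[OF directed_fcfs_regen_matching[OF x]
        waiting_regen_matching_empty[OF x assms(2)] assms(3)]
    by (auto simp: waiting_def)
  then show ?thesis using wait_from_lists[OF assms(3)] by metis
qed

lemma old_queue_empty_at:
  assumes x: "regenerative G x" and "empty_at G x N0" and "N0 \<le> N"
    and "empty_at G x N1" and "N \<le> N1"
  shows "old_queue G (queue_from G x N0 N) (map x [N+1..N1]) = []"
proof -
  let ?A = "regen_matching G x"
  obtain ps where ps: "lists_waiting x ps (queue_from G x N0 N) (waiting x ?A N \<inter> {..N})"
    using queue_from_lists_waiting[OF assms(1-3)] by blast
  obtain d where d: "N1 = N + int d" using assms(5) zle_iff_zadd by blast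
  have "waiting x ?A N1 = {}"
    using waiting_regen_matching_empty x assms(4) by blast
  then show ?thesis
    using old_entries_eq_exchange[OF directed_fcfs_regen_matching[OF x] order.refl ps, of d]
      lists_waiting_empty_iff unfolding d by fastforce
qed

text \<open>About \<open>N1\<close> it is only asked that the agents up to \<open>N\<close> have
  been served by then; newer ones may still be waiting. This can be checked on a finite word without
  continuing it to the next regeneration.\<close>

lemma W_eq_trim_end:
  assumes x: "regenerative G x" and "empty_at G x N0" and "N0 \<le> N" and "N \<le> N1"
    and old: "old_queue G (queue_from G x N0 N) (map x [N+1..N1]) = []"
  shows "W G x N = trim_end (old_entries G (queue_from G x N0 N) (map x [N+1..N1]))"
proof -
  let ?A = "regen_matching G x"
  define B where "B = {(m, n). (m, n) \<in> ?A \<and> m \<le> N}"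
  define T where "T = {n. N < n \<and> (\<exists>m. (m, n) \<in> B)}"
  note A = directed_fcfs_regen_matching[OF x]
  have B_iff: "(m, n) \<in> B \<longleftrightarrow> (m, n) \<in> ?A \<and> m \<le> N" for m n
    by (simp add: B_def)
  have T_iff: "n \<in> T \<longleftrightarrow> N < n \<and> (\<exists>m. (m, n) \<in> B)" for n
    by (simp add: T_def)
  have B: "B \<subseteq> ?A" unfolding B_def by blast
  obtain ps where ps: "lists_waiting x ps (queue_from G x N0 N) (waiting x ?A N \<inter> {..N})"
    using queue_from_lists_waiting[OF assms(1-3)] by blast
  obtain d where d: "N1 = N + int d" using assms(4) zle_iff_zadd by blast
  note old_entries = old_entries_eq_exchange[OF A order.refl ps, of d, folded d B_def]
  note entries = conjunct1[OF old_entries, symmetric]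
  have none: "waiting x ?A N1 \<inter> {..N} = {}"
    using conjunct2[OF old_entries] unfolding old by (metis lists_waiting_empty_iff)
  have T: "n \<le> N1" if n: "n \<in> T" for n
  proof (rule ccontr)
    assume "\<not> n \<le> N1"
    moreover obtain m where m: "(m, n) \<in> ?A" "m \<le> N" using n T_iff B_iff by blast
    ultimately have "m \<in> waiting x ?A N1"
      using fcfs_pairD(4)[OF A m(1)] assms(4) by (auto simp: waiting_def)
    with none m show False by blast
  qed
  have exch: "exchanged_agent (exchange x B p) \<longleftrightarrow> p \<in> T" if "N < p" for p
  proof (cases "\<exists>m. (m, p) \<in> B")
    case True
    then obtain m where m: "(m, p) \<in> B" by blast
    moreover obtain c where "x m = Agent c"
      using fcfs_pairD(2)[OF A, of m p] m B_iff by blast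
    ultimately have "exchanged_agent (exchange x B p)"
      unfolding exchange_at_good[OF A B m] exchanged_agent_def by blast
    with True that T_iff show ?thesis by simp
  next
    case False
    have "\<not> (\<exists>n. (p, n) \<in> B)" using that B_iff by simp
    then have "exchange x B p = Plain (x p)"
      using False by (rule exchange_unmatched)
    then have "\<not> exchanged_agent (exchange x B p)"
      unfolding exchanged_agent_def by simp
    with False T_iff show ?thesis by simp
  qed
  \<comment> \<open>The definition of \<open>W\<close> tests for waiting agents, whereas
    \<open>trim_end\<close> sees exchanged entries. The two tests agree because every agent waiting
    at \<open>N\<close> is served in between \<open>N\<close> and \<open>N1\<close>.\<close>
  have empty_iff: "waiting x ?A N = {} \<longleftrightarrow> T = {}"
  proof
    assume empty: "waiting x ?A N = {}"
    have False if n: "n \<in> T" for n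
    proof -
      obtain m where m: "(m, n) \<in> ?A" "m \<le> N" "N < n" using n T_iff B_iff by blast
      then have "m \<in> waiting x ?A N"
        using fcfs_pairD(4)[OF A m(1)] by (auto simp: waiting_def)
      with empty show False by blast
    qed
    then show "T = {}" by blast
  next
    assume T: "T = {}"
    have False if m: "m \<in> waiting x ?A N" for m
    proof -
      have "m \<notin> waiting x ?A N1" "m \<le> N"
        using none m by (auto simp: waiting_def)
      then obtain n where n: "(m, n) \<in> ?A"
        using m assms(4) by (auto simp: waiting_def)
      then have "\<not> n \<le> N" using m by (auto simp: waiting_def)
      then have "n \<in> T" using n \<open>m \<le> N\<close> T_iff B_iff by (meson not_le)
      with T show False by blast
    qed
    then show "waiting x ?A N = {}" by blast
  qed
  have W: "W G x N = (if T = {} then [] else map (exchange x B) [N+1..Max T])"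
    unfolding W_def Let_def the_matching_eq[OF x] empty_iff B_def[symmetric] T_def[symmetric] ..
  show ?thesis
  proof (cases "T = {}")
    case True
    have "\<forall>e\<in>set (rev (map (exchange x B) [N+1..N1])). \<not> exchanged_agent e"
      using exch True by simp
    then have "trim_end (map (exchange x B) [N+1..N1]) = []"
      unfolding trim_end_def by (simp only: dropWhile_eq_Nil_conv[THEN iffD2] rev.simps)
    then show ?thesis
      unfolding W entries if_P[OF True] by simp
  next
    case False
    have "T \<subseteq> {N<..N1}" using T T_iff by auto
    then have fin: "finite T" by (rule finite_subset) simp
    define t where "t = Max T"
    have t: "t \<in> T" "\<forall>k\<in>T. k \<le> t"
      unfolding t_def using Max_in[OF fin False] Max_ge[OF fin] by auto
    then have tN: "N < t" "t \<le> N1" using T T_iff by auto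
    have split: "[N+1..N1] = [N+1..t] @ [t+1..N1]" "[N+1..t] = [N+1..t - 1] @ [t]"
      using upto_split3[of "N + 1" t N1] upto_rec2[of "N + 1" t] tN by auto
    have "\<not> exchanged_agent (exchange x B p)" if "p \<in> {t+1..N1}" for p
      using exch[of p] t(2) tN that by auto
    then have "\<forall>e\<in>set (rev (map (exchange x B) [t+1..N1])). \<not> exchanged_agent e"
      by simp
    moreover have "exchanged_agent (exchange x B t)"
      using exch[OF tN(1)] t(1) by blast
    ultimately have "trim_end (map (exchange x B) [N+1..N1]) = map (exchange x B) [N+1..t]"
      unfolding split trim_end_def by (simp add: dropWhile_append)
    then show ?thesis
      unfolding W entries if_not_P[OF False] t_def[symmetric] by simp
  qed
qed

section \<open>The product form\<close>

locale stable_queue =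
  fixes G :: "('s::finite \<times> 'c::finite) set" and p :: "('c, 's) item pmf"
  assumes pmf_pos: "\<And>i. pmf p i > 0"
    and stable: "\<And>C. C \<noteq> {} \<Longrightarrow>
      (\<Sum>c\<in>C. pmf p (Agent c)) < (\<Sum>s\<in>compatible_goods G C. pmf p (Good s))"
begin

definition rate :: "'c set \<Rightarrow> real" where
  "rate C = (\<Sum>s\<in>compatible_goods G C. pmf p (Good s))"

lemma rate_empty [simp]: "rate {} = 0"
  by (simp add: rate_def compatible_goods_def)

lemma rate_pos: "C \<noteq> {} \<Longrightarrow> rate C > 0"
  unfolding rate_def using stable[of C] sum_nonneg[of C "\<lambda>c. pmf p (Agent c)"] by simp

lemma rate_mono: "C \<subseteq> D \<Longrightarrow> rate C \<le> rate D"
  unfolding rate_def by (intro sum_mono2) (auto simp: compatible_goods_def)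

lemma compatible_good_exists: "\<exists>s. (s, c) \<in> G"
proof -
  have "rate {c} > 0" by (rule rate_pos) simp
  then have "compatible_goods G {c} \<noteq> {}" unfolding rate_def by fastforce
  then show ?thesis by (auto simp: compatible_goods_def)
qed

text \<open>
  The stationary measure of the first-come-first-served queue has the product form
  \<open>weight (c\<^sub>1 \<dots> c\<^sub>n) = (\<Prod>i. \<lambda> c\<^sub>i / \<mu> (\<S> {c\<^sub>1, \<dots>, c\<^sub>i}))\<close>;
  the recursion runs over the reversed list.
\<close>

primrec rev_weight :: "'c list \<Rightarrow> real" where
  "rev_weight [] = 1"
| "rev_weight (c # q) = rev_weight q * pmf p (Agent c) / rate (insert c (set q))"

definition weight :: "'c list \<Rightarrow> real" where
  "weight q = rev_weight (rev q)"

lemma weight_Nil [simp]: "weight [] = 1"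
  by (simp add: weight_def)

lemma weight_snoc: "weight (q @ [c]) = weight q * pmf p (Agent c) / rate (insert c (set q))"
  by (simp add: weight_def)

lemma weight_nonneg: "weight q \<ge> 0"
proof (induction q rule: rev_induct)
  case (snoc c q)
  then show ?case using rate_pos[of "insert c (set q)"] by (simp add: weight_snoc)
qed simp

text \<open>Partial balance for one type. The rate difference belongs to the goods compatible with
  the inserted \<open>c\<close> but with nobody ahead of it, so the left side is the flow into
  \<open>y\<close> by services of a \<open>c\<close>, and the right side the flow out of
  \<open>y\<close> by arrivals of type \<open>c\<close>. In the induction, the terms with
  \<open>c\<close> before the new last letter \<open>d\<close> share one factor, and the term with
  \<open>c\<close> behind \<open>d\<close> supplies exactly the missing part.\<close>

lemma sum_weight_insert:
  "(\<Sum>i\<le>length y. weight (take i y @ c # drop i y) *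
      (rate (insert c (set (take i y))) - rate (set (take i y)))) = weight y * pmf p (Agent c)"
proof (induction y rule: rev_induct)
  case Nil
  then show ?case using rate_pos[of "{c}"] weight_snoc[of "[]" c] by simp
next
  case (snoc d y)
  let ?R = "rate (insert c (insert d (set y)))"
  let ?r = "rate (insert d (set y))"
  let ?D = "\<lambda>i. rate (insert c (set (take i y))) - rate (set (take i y))"
  have R: "?R > 0" "?r > 0" by (auto intro: rate_pos)
  have "(\<Sum>i\<le>length (y @ [d]). weight (take i (y @ [d]) @ c # drop i (y @ [d])) *
      (rate (insert c (set (take i (y @ [d])))) - rate (set (take i (y @ [d]))))) =
      (\<Sum>i\<le>length y. weight ((take i y @ c # drop i y) @ [d]) * ?D i) +
      weight ((y @ [d]) @ [c]) * (?R - ?r)"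
    by simp
  also have "(\<Sum>i\<le>length y. weight ((take i y @ c # drop i y) @ [d]) * ?D i) =
      (\<Sum>i\<le>length y. weight (take i y @ c # drop i y) * ?D i) * (pmf p (Agent d) / ?R)"
  proof -
    \<comment> \<open>The factor contributed by \<open>d\<close> depends only on the set of letters
      up to \<open>d\<close>, hence not on where \<open>c\<close> was inserted.\<close>
    have "set (take i y @ c # drop i y) = insert c (set y)" for i
      by (metis append_take_drop_id set_append list.simps(15) Un_insert_right)
    then show ?thesis
      unfolding weight_snoc sum_distrib_right by (simp add: insert_commute field_simps)
  qed
  also have "\<dots> = weight y * pmf p (Agent c) * (pmf p (Agent d) / ?R)"
    by (simp add: snoc.IH)
  also have "weight ((y @ [d]) @ [c]) = weight y * pmf p (Agent d) / ?r * pmf p (Agent c) / ?R"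
    unfolding weight_snoc by simp
  also have "weight y * pmf p (Agent c) * (pmf p (Agent d) / ?R) +
      weight y * pmf p (Agent d) / ?r * pmf p (Agent c) / ?R * (?R - ?r) =
      weight y * pmf p (Agent d) / ?r * pmf p (Agent c)"
    using R by (simp add: field_simps)
  finally show ?case by (simp add: weight_snoc)
qed

text \<open>
  A word uses a new letter at most \<open>CARD('c)\<close> times.  Charging a small factor \<open>A\<close> for each new letter
  makes the total weight of the words of length \<open>n\<close> decay geometrically.
\<close>

lemma sum_weight_length:
  "\<exists>A r. 0 < A \<and> A \<le> 1 \<and> 0 \<le> r \<and> r < 1 \<and>
    (\<forall>n. (\<Sum>q | length q = n. weight q * A ^ card (set q)) \<le> r ^ n)"
proof -
  let ?a = "\<lambda>c. pmf p (Agent c)"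
  let ?rho = "\<lambda>C. (\<Sum>c\<in>C. ?a c) / rate C"
  define \<rho> where "\<rho> = Max (?rho ` UNIV)"
  have fin: "finite (?rho ` UNIV)" by simp
  have rho_le: "?rho C \<le> \<rho>" for C
    unfolding \<rho>_def by (rule Max_ge) auto
  have "\<rho> \<in> ?rho ` UNIV" unfolding \<rho>_def by (rule Max_in) auto
  then obtain C where C: "\<rho> = ?rho C" by blast
  \<comment> \<open>The maximum may be attained at the empty set, where \<open>?rho {}\<close> is 0
    / 0 = 0; that value also gives the lower bound.\<close>
  have \<rho>: "\<rho> < 1" "0 \<le> \<rho>"
  proof -
    show "\<rho> < 1"
    proof (cases "C = {}")
      case False
      then show ?thesis using stable[of C] rate_pos[of C] by (simp add: C rate_def)
    qed (simp add: C)
    show "0 \<le> \<rho>" using rho_le[of "{}"] by simp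
  qed
  define b where "b = (\<Sum>c\<in>UNIV. ?a c / rate {c})"
  have b: "b \<ge> 0" unfolding b_def by (intro sum_nonneg divide_nonneg_pos) (auto intro: rate_pos)
  \<comment> \<open>Chosen so that \<open>A * b\<close> is at most half of
    \<open>1 - \<rho>\<close>, which keeps \<open>r\<close> below 1; the summand 1 in
    \<open>b + 1\<close> makes the denominator positive. That \<open>A\<close> is at most 1 is
    needed to remove the charge afterwards.\<close>
  define A where "A = (1 - \<rho>) / (2 * (b + 1))"
  define r where "r = \<rho> + A * b"
  have A: "0 < A" "A \<le> 1" using \<rho> b by (auto simp: A_def field_simps)
  have "A * b \<le> A * (b + 1)" using A by (intro mult_left_mono) auto
  also have "\<dots> = (1 - \<rho>) / 2"
  proof -
    have "x / (2 * B) * B = x / 2" if "B \<noteq> 0" for x B :: real using that by simp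
    from this[of "b + 1" "1 - \<rho>"] show ?thesis using b by (simp only: A_def)
  qed
  finally have r: "0 \<le> r" "r < 1" using \<rho> A b by (auto simp: r_def)
  \<comment> \<open>Letters already present contribute the load of \<open>S\<close>, at most
    \<open>\<rho>\<close>. A new letter has a denominator of at least \<open>rate {c}\<close>, so
    all new ones together contribute at most \<open>A * b\<close>.\<close>
  have step: "(\<Sum>c\<in>UNIV. ?a c / rate (insert c S) * (if c \<in> S then 1 else A)) \<le> r" for S
  proof -
    have "(\<Sum>c\<in>UNIV. ?a c / rate (insert c S) * (if c \<in> S then 1 else A)) =
        (\<Sum>c\<in>S. ?a c / rate (insert c S) * (if c \<in> S then 1 else A)) +
        (\<Sum>c\<in>- S. ?a c / rate (insert c S) * (if c \<in> S then 1 else A))"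
      by (subst sum.union_disjoint[symmetric]) auto
    also have "(\<Sum>c\<in>S. ?a c / rate (insert c S) * (if c \<in> S then 1 else A)) = ?rho S"
      by (simp add: sum_divide_distrib insert_absorb)
    also have "(\<Sum>c\<in>- S. ?a c / rate (insert c S) * (if c \<in> S then 1 else A)) \<le>
        (\<Sum>c\<in>- S. A * (?a c / rate {c}))"
    proof (rule sum_mono)
      fix c assume c: "c \<in> - S"
      have "?a c / rate (insert c S) \<le> ?a c / rate {c}" (is "?u \<le> ?v")
        by (intro divide_left_mono mult_pos_pos rate_mono rate_pos) auto
      then have "A * ?u \<le> A * ?v" using A by (intro mult_left_mono) auto
      then show "?u * (if c \<in> S then 1 else A) \<le> A * ?v"
        using c by (simp add: mult.commute)
    qed
    also have "\<dots> \<le> A * b"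
      unfolding b_def sum_distrib_left using A
      by (intro sum_mono2) (auto intro!: mult_nonneg_nonneg divide_nonneg_pos rate_pos)
    finally show ?thesis using rho_le[of S] by (simp add: r_def)
  qed
  have fin: "finite {q :: 'c list. length q = n}" for n
    using finite_lists_length_eq[of "UNIV :: 'c set" n] by simp
  have "(\<Sum>q | length q = n. weight q * A ^ card (set q)) \<le> r ^ n" for n
  proof (induction n)
    case (Suc n)
    let ?snoc = "\<lambda>(q, c). q @ [c] :: 'c list"
    have im: "{q :: 'c list. length q = Suc n} = ?snoc ` ({q. length q = n} \<times> UNIV)"
    proof (intro set_eqI iffI)
      fix q :: "'c list" assume "q \<in> {q. length q = Suc n}"
      then show "q \<in> ?snoc ` ({q. length q = n} \<times> UNIV)"
        by (cases q rule: rev_cases) auto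
    qed auto
    have inj: "inj_on ?snoc ({q. length q = n} \<times> UNIV)"
      by (auto simp: inj_on_def)
    have "(\<Sum>q | length q = Suc n. weight q * A ^ card (set q)) =
        (\<Sum>q | length q = n. \<Sum>c\<in>UNIV. weight (q @ [c]) * A ^ card (set (q @ [c])))"
      unfolding im sum.reindex[OF inj] sum.cartesian_product by (simp add: case_prod_unfold)
    also have "\<dots> = (\<Sum>q | length q = n. weight q * A ^ card (set q) *
        (\<Sum>c\<in>UNIV. ?a c / rate (insert c (set q)) * (if c \<in> set q then 1 else A)))"
      unfolding sum_distrib_left
      by (intro sum.cong refl) (auto simp: weight_snoc card_insert_if insert_absorb)
    also have "\<dots> \<le> (\<Sum>q | length q = n. weight q * A ^ card (set q) * r)"
      using A weight_nonneg by (intro sum_mono mult_left_mono step) auto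
    also have "\<dots> \<le> r ^ n * r"
      unfolding sum_distrib_right[symmetric] using Suc r by (intro mult_right_mono) auto
    finally show ?case by (simp add: mult.commute)
  qed simp
  with A r show ?thesis by blast
qed

text \<open>Each word is charged a factor of at least \<open>A ^ CARD('c)\<close>, so removing the
  charge costs only a constant, and the bounds for the single lengths form a geometric
  series.\<close>

lemma weight_summable: "weight summable_on UNIV"
proof -
  obtain A r where A: "0 < A" "A \<le> 1" and r: "0 \<le> r" "r < 1"
    and sum: "\<And>n. (\<Sum>q | length q = n. weight q * A ^ card (set q)) \<le> r ^ n"
    using sum_weight_length by blast
  let ?K = "A ^ card (UNIV :: 'c set)"
  have fin: "finite {q :: 'c list. length q = n}" for n
    using finite_lists_length_eq[of "UNIV :: 'c set" n] by simp
  have K: "?K > 0" using A by simp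
  have len: "(\<Sum>q | length q = n. weight q) \<le> r ^ n / ?K" for n
  proof -
    have "?K * (\<Sum>q | length q = n. weight q) \<le> (\<Sum>q | length q = n. weight q * A ^ card (set q))"
      unfolding sum_distrib_left
    proof (rule sum_mono)
      fix q :: "'c list"
      have "?K \<le> A ^ card (set q)"
        using A by (intro power_decreasing card_mono) auto
      then show "?K * weight q \<le> weight q * A ^ card (set q)"
        using weight_nonneg[of q] by (subst mult.commute) (rule mult_left_mono)
    qed
    also have "\<dots> \<le> r ^ n" by (rule sum)
    finally show ?thesis using K by (simp add: field_simps)
  qed
  have "sum weight F \<le> 1 / (1 - r) / ?K" if F: "finite F" for F :: "'c list set"
  proof -
    define N where "N = (\<Sum>q\<in>F. Suc (length q))"
    have "F \<subseteq> (\<Union>n<N. {q. length q = n})"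
    proof
      fix q assume "q \<in> F"
      then have "Suc (length q) \<le> N"
        unfolding N_def using F by (intro member_le_sum) auto
      then show "q \<in> (\<Union>n<N. {q. length q = n})" by auto
    qed
    then have "sum weight F \<le> sum weight (\<Union>n<N. {q. length q = n})"
      using fin weight_nonneg by (intro sum_mono2) auto
    also have "\<dots> = (\<Sum>n<N. \<Sum>q | length q = n. weight q)"
      using fin by (intro sum.UNION_disjoint) auto
    also have "\<dots> \<le> (\<Sum>n<N. r ^ n / ?K)"
      by (intro sum_mono len)
    also have "\<dots> = (\<Sum>n<N. r ^ n) / ?K"
      by (simp add: sum_divide_distrib)
    also have "(\<Sum>n<N. r ^ n) \<le> 1 / (1 - r)"
    proof -
      have "(\<Sum>n<N. r ^ n) = (1 - r ^ N) / (1 - r)"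
        using r by (subst sum_gp_strict) auto
      also have "\<dots> \<le> 1 / (1 - r)"
        using r by (intro divide_right_mono) auto
      finally show ?thesis .
    qed
    finally show ?thesis using K by (simp add: divide_right_mono)
  qed
  then show ?thesis
    using weight_nonneg by (intro nonneg_bdd_above_summable_on) (auto simp: bdd_above_def)
qed

lemma stationary_queue:
  obtains \<pi> Z where "Z > 0" "\<And>q. pmf \<pi> q = weight q / Z"
proof
  define Z where "Z = infsum weight UNIV"
  have "sum weight {[]} \<le> Z"
    unfolding Z_def using weight_summable weight_nonneg by (intro finite_sum_le_infsum) auto
  then show Z: "Z > 0" by simp
  define f where "f q = weight q / Z" for q
  have nonneg: "f q \<ge> 0" for q using Z weight_nonneg by (simp add: f_def)
  have "Infinite_Set_Sum.abs_summable_on weight UNIV"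
    using weight_summable weight_nonneg by (simp add: abs_summable_equivalent[symmetric])
  then have "(\<integral>\<^sup>+q. ennreal (weight q) \<partial>count_space UNIV) = ennreal Z"
    using weight_nonneg
    by (simp add: nn_integral_conv_infsetsum infsetsum_infsum Z_def)
  then have "(\<integral>\<^sup>+q. ennreal (weight q) / ennreal Z \<partial>count_space UNIV) = 1"
    using Z by (simp add: nn_integral_divide ennreal_divide_self)
  then have int: "(\<integral>\<^sup>+q. ennreal (f q) \<partial>count_space UNIV) = 1"
    using Z weight_nonneg by (simp add: f_def divide_ennreal)
  show "pmf (embed_pmf f) q = weight q / Z" for q
    using pmf_embed_pmf[of f q] nonneg int by (simp add: f_def)
qed

end

text \<open>A preimage of \<open>y\<close> is \<open>y\<close> itself, if nothing is removed, or
  \<open>y\<close> with the removed entry put back at index \<open>i\<close>. As this entry is the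
  first one satisfying \<open>P\<close>, nothing before it satisfies \<open>P\<close>, and no list
  is counted twice. Finiteness is proved along because splitting the sum requires it.\<close>

lemma sum_remove_first_preimage:
  fixes f :: "'c::finite list \<Rightarrow> real"
  shows "finite {q. remove_first P q = y} \<and> (\<Sum>q | remove_first P q = y. f q) =
    (if \<exists>c\<in>set y. P c then 0 else f y) +
    (\<Sum>i\<le>length y. \<Sum>c\<in>UNIV.
      if P c \<and> (\<forall>d\<in>set (take i y). \<not> P d) then f (take i y @ c # drop i y) else 0)"
proof (induction y arbitrary: f)
  case Nil
  have eq: "{q. remove_first P q = []} = insert [] ((\<lambda>c. [c]) ` {c. P c})" (is "?L = ?R")
  proof (intro set_eqI iffI)
    fix q assume "q \<in> ?L"
    then show "q \<in> ?R" by (cases q) (auto split: if_splits)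
  qed auto
  have "(\<Sum>q\<in>(\<lambda>c. [c]) ` {c. P c}. f q) = (\<Sum>c\<in>UNIV. if P c then f [c] else 0)"
    by (subst sum.reindex) (auto simp: inj_on_def sum.If_cases)
  moreover have "(\<Sum>q\<in>insert [] ((\<lambda>c. [c]) ` {c. P c}). f q) =
      f [] + (\<Sum>q\<in>(\<lambda>c. [c]) ` {c. P c}. f q)"
    by (intro sum.insert) auto
  ultimately show ?case
    unfolding eq by (simp cong: if_cong)
next
  case (Cons d y)
  let ?N = "if P d then {} else (#) d ` {q. remove_first P q = y}"
  let ?C = "(\<lambda>c. c # d # y) ` {c. P c}"
  have eq: "{q. remove_first P q = d # y} = ?C \<union> ?N" (is "?L = ?R")
  proof (intro set_eqI iffI)
    fix q assume "q \<in> ?L"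
    then show "q \<in> ?R" by (cases q) (auto split: if_splits)
  qed (auto split: if_splits)
  have fin: "finite ?N" using Cons by auto
  have C: "(\<Sum>q\<in>?C. f q) = (\<Sum>c\<in>UNIV. if P c then f (c # d # y) else 0)"
    by (subst sum.reindex) (auto simp: inj_on_def sum.If_cases)
  have N: "(\<Sum>q\<in>?N. f q) = (if P d then 0 else (\<Sum>q | remove_first P q = y. f (d # q)))"
    by (auto simp: sum.reindex)
  have "(\<Sum>q | remove_first P q = d # y. f q) = (\<Sum>q\<in>?C. f q) + (\<Sum>q\<in>?N. f q)"
    unfolding eq using fin by (intro sum.union_disjoint) (auto split: if_splits)
  then show ?case
    unfolding C N using fin Cons.IH[of "\<lambda>q. f (d # q)"]
    by (auto simp: eq sum.atMost_Suc_shift simp del: sum.atMost_Suc cong: if_cong)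
qed

lemma UNIV_item: "UNIV = range Agent \<union> range Good"
proof -
  have "i \<in> range Agent \<union> range Good" for i by (cases i) auto
  then show ?thesis by blast
qed

lemma finite_item: "finite (UNIV :: ('c::finite, 's::finite) item set)"
  unfolding UNIV_item by simp

lemma sum_item:
  fixes f :: "('c::finite, 's::finite) item \<Rightarrow> real"
  shows "(\<Sum>i\<in>UNIV. f i) = (\<Sum>c\<in>UNIV. f (Agent c)) + (\<Sum>s\<in>UNIV. f (Good s))"
proof -
  have "(\<Sum>i\<in>UNIV. f i) = (\<Sum>i\<in>range Agent. f i) + (\<Sum>i\<in>range Good. f i)"
    unfolding UNIV_item by (intro sum.union_disjoint) auto
  then show ?thesis by (simp add: sum.reindex inj_on_def)
qed

context stable_queue
begin

text \<open>Global balance with three inflows into \<open>y\<close>. The arrival of its last agent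
  contributes \<open>weight y * rate (set y)\<close>, lost goods contribute \<open>weight y\<close>
  times the mass of the goods useless to \<open>y\<close>, and services contribute
  \<open>weight y\<close> times the mass of all agents by partial balance. Together this is
  \<open>weight y\<close>, as the masses of all items add up to 1.\<close>

lemma stationary_queue_invariant:
  assumes Z: "Z > 0" and \<pi>: "\<And>q. pmf \<pi> q = weight q / Z"
  shows "bind_pmf \<pi> (\<lambda>q. map_pmf (serve G q) p) = \<pi>"
proof (rule pmf_eqI)
  fix y
  let ?a = "\<lambda>c. pmf p (Agent c)" and ?g = "\<lambda>s. pmf p (Good s)"
  have "bind_pmf \<pi> (\<lambda>q. map_pmf (serve G q) p) = bind_pmf p (\<lambda>i. map_pmf (\<lambda>q. serve G q i) \<pi>)"
    unfolding map_pmf_def by (rule bind_commute_pmf)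
  then have "pmf (bind_pmf \<pi> (\<lambda>q. map_pmf (serve G q) p)) y =
      (\<Sum>i\<in>UNIV. measure \<pi> {q. serve G q i = y} * pmf p i)"
    by (simp add: pmf_bind pmf_map vimage_def integral_measure_pmf_real[OF finite_item])
  also have "\<dots> = (\<Sum>c\<in>UNIV. measure \<pi> {q. q @ [c] = y} * ?a c) +
      (\<Sum>s\<in>UNIV. measure \<pi> {q. remove_first (\<lambda>c. (s, c) \<in> G) q = y} * ?g s)"
    by (simp add: sum_item serve_def)
  also have "(\<Sum>c\<in>UNIV. measure \<pi> {q. q @ [c] = y} * ?a c) = weight y * rate (set y) / Z"
  proof (cases y rule: rev_cases)
    case (snoc y' d)
    have "{q. q @ [c] = y} = (if c = d then {y'} else {})" for c
      by (auto simp: snoc)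
    then have "(\<Sum>c\<in>UNIV. measure \<pi> {q. q @ [c] = y} * ?a c) =
        (\<Sum>c\<in>UNIV. if c = d then pmf \<pi> y' * ?a d else 0)"
      by (intro sum.cong) (auto simp: measure_pmf_single)
    then show ?thesis
      using rate_pos[of "insert d (set y')"] by (simp add: \<pi> snoc weight_snoc)
  qed simp
  also have "(\<Sum>s\<in>UNIV. measure \<pi> {q. remove_first (\<lambda>c. (s, c) \<in> G) q = y} * ?g s) =
      (weight y * ((\<Sum>s\<in>UNIV. ?g s) - rate (set y)) + weight y * (\<Sum>c\<in>UNIV. ?a c)) / Z"
  proof -
    let ?ins = "\<lambda>i c. take i y @ c # drop i y"
    let ?new = "\<lambda>s i c. (s, c) \<in> G \<and> (\<forall>d\<in>set (take i y). (s, d) \<notin> G)"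
    have meas: "measure \<pi> {q. remove_first (\<lambda>c. (s, c) \<in> G) q = y} =
        ((if \<exists>c\<in>set y. (s, c) \<in> G then 0 else weight y) +
         (\<Sum>i\<le>length y. \<Sum>c\<in>UNIV. if ?new s i c then weight (?ins i c) else 0)) / Z" for s
    proof -
      note pre = sum_remove_first_preimage[of "\<lambda>c. (s, c) \<in> G" y weight]
      have "measure \<pi> {q. remove_first (\<lambda>c. (s, c) \<in> G) q = y} =
          (\<Sum>q | remove_first (\<lambda>c. (s, c) \<in> G) q = y. weight q) / Z"
        using conjunct1[OF pre]
        by (simp only: measure_measure_pmf_finite sum_divide_distrib ext[of "pmf \<pi>", OF \<pi>])
      then show ?thesis by (simp only: conjunct2[OF pre])
    qed
    have lost: "(\<Sum>s\<in>UNIV. (if \<exists>c\<in>set y. (s, c) \<in> G then 0 else weight y) * ?g s) =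
        weight y * ((\<Sum>s\<in>UNIV. ?g s) - rate (set y))"
    proof -
      have "(\<Sum>s\<in>UNIV. (if \<exists>c\<in>set y. (s, c) \<in> G then 0 else weight y) * ?g s) =
          (\<Sum>s\<in>UNIV. weight y * (?g s - (if s \<in> compatible_goods G (set y) then ?g s else 0)))"
        by (intro sum.cong) (auto simp: compatible_goods_def)
      also have "\<dots> = weight y * ((\<Sum>s\<in>UNIV. ?g s) -
          (\<Sum>s\<in>UNIV. if s \<in> compatible_goods G (set y) then ?g s else 0))"
        unfolding sum_distrib_left[symmetric] sum_subtractf ..
      finally show ?thesis by (simp add: rate_def sum.If_cases)
    qed
    \<comment> \<open>The goods that pass over the first \<open>i\<close> agents and take the
      inserted \<open>c\<close> are those that \<open>c\<close> adds to the compatible ones.\<close>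
    have new: "(\<Sum>s\<in>UNIV. if ?new s i c then ?g s else 0) =
        rate (insert c (set (take i y))) - rate (set (take i y))" for i c
    proof -
      let ?T = "set (take i y)"
      have "rate (insert c ?T) - rate ?T = (\<Sum>s\<in>compatible_goods G (insert c ?T) - compatible_goods G ?T. ?g s)"
        unfolding rate_def by (subst sum_diff) (auto simp: compatible_goods_def)
      also have "compatible_goods G (insert c ?T) - compatible_goods G ?T = {s. ?new s i c}"
        by (auto simp: compatible_goods_def)
      finally show ?thesis by (simp add: sum.If_cases)
    qed
    have "(\<Sum>s\<in>UNIV. (\<Sum>i\<le>length y. \<Sum>c\<in>UNIV. if ?new s i c then weight (?ins i c) else 0) * ?g s) =
        (\<Sum>s\<in>UNIV. \<Sum>i\<le>length y. \<Sum>c\<in>UNIV. weight (?ins i c) * (if ?new s i c then ?g s else 0))"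
      unfolding sum_distrib_right by (intro sum.cong refl) auto
    also have "\<dots> = (\<Sum>c\<in>UNIV. \<Sum>i\<le>length y. \<Sum>s\<in>UNIV. weight (?ins i c) * (if ?new s i c then ?g s else 0))"
      by (subst sum.swap, subst sum.swap[of _ UNIV "{..length y}"], subst (2) sum.swap) simp
    also have "\<dots> = (\<Sum>c\<in>UNIV. \<Sum>i\<le>length y. weight (?ins i c) *
        (rate (insert c (set (take i y))) - rate (set (take i y))))"
      unfolding sum_distrib_left[symmetric] new ..
    also have "\<dots> = weight y * (\<Sum>c\<in>UNIV. ?a c)"
      by (simp add: sum_weight_insert sum_distrib_left)
    finally have ins: "(\<Sum>s\<in>UNIV. (\<Sum>i\<le>length y. \<Sum>c\<in>UNIV. if ?new s i c then weight (?ins i c) else 0) * ?g s) =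
        weight y * (\<Sum>c\<in>UNIV. ?a c)" .
    show ?thesis
      unfolding meas lost[symmetric] ins[symmetric] sum.distrib[symmetric] sum_divide_distrib
      by (intro sum.cong refl) (simp add: field_simps)
  qed
  also have "weight y * rate (set y) / Z +
      (weight y * ((\<Sum>s\<in>UNIV. ?g s) - rate (set y)) + weight y * (\<Sum>c\<in>UNIV. ?a c)) / Z =
      weight y * ((\<Sum>c\<in>UNIV. ?a c) + (\<Sum>s\<in>UNIV. ?g s)) / Z"
    unfolding add_divide_distrib[symmetric] by (simp add: algebra_simps)
  also have "(\<Sum>c\<in>UNIV. ?a c) + (\<Sum>s\<in>UNIV. ?g s) = 1"
    using sum_item[of "pmf p"] sum_pmf_eq_1[OF finite_item, of p] by simp
  finally show "pmf (bind_pmf \<pi> (\<lambda>q. map_pmf (serve G q) p)) y = pmf \<pi> y"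
    by (simp add: \<pi>)
qed

text \<open>
  Started from the stationary distribution, the queue is empty with constant probability, and a queue
  started empty is a subsequence of it.
\<close>

lemma queue_empty_bound:
  "\<exists>\<epsilon>>0. \<forall>n. measure (replicate_pmf n p) {v. foldl (serve G) [] v = []} \<ge> \<epsilon>"
proof -
  obtain \<pi> Z where Z: "Z > 0" and \<pi>: "\<And>q. pmf \<pi> q = weight q / Z"
    using stationary_queue by blast
  note inv = stationary_queue_invariant[OF Z \<pi>]
  have invn: "bind_pmf \<pi> (\<lambda>q. map_pmf (foldl (serve G) q) (replicate_pmf n p)) = \<pi>" for n
  proof (induction n)
    case (Suc n)
    have "bind_pmf \<pi> (\<lambda>q. map_pmf (foldl (serve G) q) (replicate_pmf (Suc n) p)) =
        bind_pmf (bind_pmf \<pi> (\<lambda>q. map_pmf (serve G q) p))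
          (\<lambda>q. map_pmf (foldl (serve G) q) (replicate_pmf n p))"
      by (simp add: map_bind_pmf bind_assoc_pmf bind_map_pmf map_pmf_def bind_return_pmf)
    then show ?case by (simp add: inv Suc)
  qed (simp add: bind_return_pmf')
  have "pmf \<pi> [] \<le> measure (replicate_pmf n p) {v. foldl (serve G) [] v = []}" for n
  proof -
    let ?f = "\<lambda>q. measure (replicate_pmf n p) {v. foldl (serve G) q v = []}"
    have "pmf \<pi> [] =
        pmf (bind_pmf \<pi> (\<lambda>q. map_pmf (foldl (serve G) q) (replicate_pmf n p))) []"
      by (simp only: invn)
    also have "\<dots> = (\<integral>q. ?f q \<partial>measure_pmf \<pi>)"
      by (simp add: pmf_bind pmf_map vimage_def)
    also have "\<dots> \<le> ?f []"
    proof (rule measure_pmf.integral_le_const)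
      show "integrable (measure_pmf \<pi>) ?f"
        by (rule measure_pmf.integrable_const_bound[where B = 1]) auto
      have "?f q \<le> ?f []" for q
      proof (rule measure_pmf.finite_measure_mono)
        show "{v. foldl (serve G) q v = []} \<subseteq> {v. foldl (serve G) [] v = []}"
        proof safe
          fix v assume "foldl (serve G) q v = []"
          then have "subseq (foldl (serve G) [] v) []"
            using subseq_foldl_serve[of "[]" q G v] by simp
          then show "foldl (serve G) [] v = []" by simp
        qed
      qed simp
      then show "AE q in measure_pmf \<pi>. ?f q \<le> ?f []" by simp
    qed
    finally show ?thesis .
  qed
  moreover have "pmf \<pi> [] > 0" using Z by (simp add: \<pi>)
  ultimately show ?thesis by blast
qed

end

section \<open>Regenerations occur almost surely\<close>

text \<open>Measurability is assumed only for the positions in \<open>L\<close>, and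
  \<open>N\<close> is arbitrary, so that the lemma serves \<open>M\<close>, the sequence space and
  the sigma-algebras generated by early items alone.\<close>

lemma pred_map_word:
  fixes y :: "'i \<Rightarrow> 'x \<Rightarrow> ('c::finite, 's::finite) item"
  assumes "\<And>m i. m \<in> set L \<Longrightarrow> Measurable.pred N (\<lambda>\<omega>. y m \<omega> = i)"
  shows "Measurable.pred N (\<lambda>\<omega>. P (map (\<lambda>m. y m \<omega>) L))"
  using assms
proof (induction L arbitrary: P)
  case (Cons a L)
  have eq: "(\<lambda>\<omega>. P (map (\<lambda>m. y m \<omega>) (a # L))) =
      (\<lambda>\<omega>. \<exists>i\<in>UNIV. y a \<omega> = i \<and> P (i # map (\<lambda>m. y m \<omega>) L))"
    by auto
  have "Measurable.pred N (\<lambda>\<omega>. P (i # map (\<lambda>m. y m \<omega>) L))" for i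
    using Cons.IH[of "\<lambda>w. P (i # w)"] Cons.prems by simp
  moreover have "Measurable.pred N (\<lambda>\<omega>. y a \<omega> = i)" for i
    using Cons.prems by simp
  ultimately show ?case
    unfolding eq by (intro pred_intros_finite[OF finite_item] pred_intros_logic)
qed simp

lemma queue_from_antimono:
  assumes "queue_from G x k n = []" "k \<le> k'" "k' \<le> n"
  shows "queue_from G x k' n = []"
proof -
  have "[k+1..n] = [k+1..k'] @ [k'+1..n]"
    using upto_split1[of "k+1" "k'+1" n] assms by (cases "k' = n") auto
  then have "queue_from G x k n = foldl (serve G) (queue_from G x k k') (map x [k'+1..n])"
    by (simp add: queue_from_def)
  then have "subseq (queue_from G x k' n) (queue_from G x k n)"
    using subseq_foldl_serve[of "[]" "queue_from G x k k'" G] by (simp add: queue_from_def)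
  with assms(1) show ?thesis by simp
qed

lemma empty_at_iff: "empty_at G x N \<longleftrightarrow> (\<forall>d::nat. queue_from G x (N - int d) N = [])"
proof
  assume *: "\<forall>d::nat. queue_from G x (N - int d) N = []"
  show "empty_at G x N"
    unfolding empty_at_def
  proof safe
    fix k assume "k \<le> N"
    then show "queue_from G x k N = []"
      using *[rule_format, of "nat (N - k)"] by simp
  qed
qed (simp add: empty_at_def)

definition shift :: "int \<Rightarrow> (int \<Rightarrow> 'a) \<Rightarrow> int \<Rightarrow> 'a" where
  "shift k x = (\<lambda>n. x (n + k))"

lemma map_shift: "map (shift k x) [a..b] = map x [a + k..b + k]"
  by (rule nth_equalityI) (auto simp: shift_def algebra_simps)

lemma queue_from_shift: "queue_from G (shift k x) a b = queue_from G x (a + k) (b + k)"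
  unfolding queue_from_def map_shift by (simp add: algebra_simps)

lemma empty_at_shift: "empty_at G (shift k x) N \<longleftrightarrow> empty_at G x (N + k)"
  unfolding empty_at_iff queue_from_shift by (simp add: algebra_simps)

lemma pred_empty_at:
  fixes y :: "int \<Rightarrow> 'x \<Rightarrow> ('c::finite, 's::finite) item"
  assumes "\<And>m i. m \<le> n \<Longrightarrow> Measurable.pred N (\<lambda>\<omega>. y m \<omega> = i)"
  shows "Measurable.pred N (\<lambda>\<omega>. empty_at G (\<lambda>m. y m \<omega>) n)"
  unfolding empty_at_iff queue_from_def
  by (intro pred_intros_countable pred_map_word assms) auto

text \<open>Being arbitrarily early is insensitive to a bound \<open>- n\<close> on the times
  considered. In this form the event visibly depends only on items up to \<open>- n\<close>, for
  every \<open>n\<close>, and its quantifiers are countable.\<close>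

lemma early_iff: "(\<forall>K. \<exists>N\<le>K. E N) \<longleftrightarrow> (\<forall>k::nat. \<exists>j::nat. E (- int n - int k - int j))"
proof safe
  fix k assume "\<forall>K. \<exists>N\<le>K. E N"
  then obtain N where "N \<le> - int n - int k" "E N" by blast
  then show "\<exists>j::nat. E (- int n - int k - int j)"
    by (intro exI[of _ "nat (- int n - int k - N)"]) simp
next
  fix K assume "\<forall>k::nat. \<exists>j::nat. E (- int n - int k - int j)"
  then obtain j where "E (- int n - int (nat (- K)) - int j)" by blast
  then show "\<exists>N\<le>K. E N" by (intro exI[of _ "- int n - int (nat (- K)) - int j"]) simp
qed

lemma pred_regenerative:
  fixes y :: "int \<Rightarrow> 'x \<Rightarrow> ('c::finite, 's::finite) item"
  assumes [measurable]: "\<And>m i. Measurable.pred N (\<lambda>\<omega>. y m \<omega> = i)"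
  shows "Measurable.pred N (\<lambda>\<omega>. regenerative G (\<lambda>m. y m \<omega>))"
proof -
  have [measurable]: "Measurable.pred N (\<lambda>\<omega>. empty_at G (\<lambda>m. y m \<omega>) n)" for n
    by (rule pred_empty_at) measurable
  show ?thesis unfolding regenerative_def by measurable
qed

section \<open>Independence and the probabilities of finite words\<close>

lemma (in prob_space) indep_sets_reindex:
  assumes "inj f" "indep_sets F UNIV"
  shows "indep_sets (\<lambda>i. F (f i)) UNIV"
proof (rule indep_setsI)
  show "F (f i) \<subseteq> events" for i
    using assms(2) by (auto simp: indep_sets_def)
next
  fix A J assume J: "J \<noteq> {}" "finite J" and A: "\<forall>j\<in>J. A j \<in> F (f j)"
  let ?B = "\<lambda>k. A (inv f k)"
  have "prob (\<Inter>k\<in>f ` J. ?B k) = (\<Prod>k\<in>f ` J. prob (?B k))"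
    using assms J A by (intro indep_setsD[OF assms(2)]) auto
  then show "prob (\<Inter>j\<in>J. A j) = (\<Prod>j\<in>J. prob (A j))"
    using assms(1) by (simp add: prod.reindex inj_on_subset[OF assms(1)])
qed

lemma (in prob_space) indep_vars_reindex:
  assumes "inj f" "indep_vars (\<lambda>_. N) X UNIV"
  shows "indep_vars (\<lambda>_. N) (\<lambda>i. X (f i)) UNIV"
  using assms(2) indep_sets_reindex[OF assms(1)] unfolding indep_vars_def2 by fastforce

lemma pmf_replicate_pmf:
  "pmf (replicate_pmf n p) w = (if length w = n then prod_list (map (pmf p) w) else 0)"
proof (induction n arbitrary: w)
  case 0
  then show ?case by (auto simp: pmf_return indicator_def)
next
  case (Suc n)
  have eq: "replicate_pmf (Suc n) p = map_pmf (\<lambda>(x, xs). x # xs) (pair_pmf p (replicate_pmf n p))"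
    by (simp add: pair_pmf_def map_bind_pmf map_pmf_def bind_assoc_pmf bind_return_pmf)
  show ?case
  proof (cases w)
    case Nil
    have "w \<notin> set_pmf (replicate_pmf (Suc n) p)" unfolding eq by (auto simp: Nil)
    then show ?thesis using Nil by (simp add: pmf_eq_0_set_pmf)
  next
    case (Cons x xs)
    have "inj (\<lambda>(x :: 'a, xs). x # xs)" by (auto simp: inj_on_def)
    from pmf_map_inj'[OF this, of "pair_pmf p (replicate_pmf n p)" "(x, xs)"]
    show ?thesis unfolding eq Cons by (simp add: pmf_pair Suc)
  qed
qed

lemma exists_map_eq:
  assumes "distinct L" "length w = length L"
  shows "\<exists>g. map g L = w"
  using assms(2,1)
proof (induction w L rule: list_induct2)
  case (Cons x xs y ys)
  then obtain g where "map g ys = xs" by auto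
  then have "map (g(y := x)) (y # ys) = x # xs" using Cons.prems by auto
  then show ?case by (rule exI[of _ "g(y := x)"])
qed simp

lemma countable_words: "countable (S :: ('c::finite, 's::finite) item list set)"
  using countable_lists[OF countable_finite[OF finite_item]] countable_subset[of S "lists UNIV"]
  by auto

locale fcfs_process = stable_queue G p + prob_space M
  for G :: "('s::finite \<times> 'c::finite) set" and p :: "('c, 's) item pmf" and M :: "'w measure" +
  fixes z :: "int \<Rightarrow> 'w \<Rightarrow> ('c, 's) item"
  assumes indep: "indep_vars (\<lambda>_. count_space UNIV) z UNIV"
    and prob_z: "\<And>n i. prob {\<omega> \<in> space M. z n \<omega> = i} = pmf p i"
begin

abbreviation path :: "'w \<Rightarrow> int \<Rightarrow> ('c, 's) item" where
  "path \<omega> \<equiv> (\<lambda>n. z n \<omega>)"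

lemma z_measurable [measurable]: "z n \<in> M \<rightarrow>\<^sub>M count_space UNIV"
  using indep by (simp add: indep_vars_def2)

lemma pred_z [measurable]: "Measurable.pred M (\<lambda>\<omega>. z n \<omega> = i)"
  by measurable

lemma events_word: "{\<omega> \<in> space M. P (map (path \<omega>) L)} \<in> events"
  using pred_map_word[where L = L and N = M and y = z and P = P] pred_z by (simp add: pred_def)

lemma prob_word_eq:
  assumes "distinct L" "length w = length L"
  shows "prob {\<omega> \<in> space M. map (path \<omega>) L = w} = prod_list (map (pmf p) w)"
proof -
  obtain g where g: "map g L = w" using exists_map_eq[OF assms] by blast
  show ?thesis
  proof (cases "L = []")
    case True
    then show ?thesis using g by (simp add: prob_space)
  next
    case False
    have "{\<omega> \<in> space M. map (path \<omega>) L = w} = (\<Inter>j\<in>set L. z j -` {g j} \<inter> space M)"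
      using False by (auto simp: g[symmetric])
    also have "prob \<dots> = (\<Prod>j\<in>set L. prob (z j -` {g j} \<inter> space M))"
      using False by (intro indep_varsD[OF indep]) auto
    also have "\<dots> = (\<Prod>j\<in>set L. pmf p (g j))"
    proof (intro prod.cong refl)
      fix j
      have "z j -` {g j} \<inter> space M = {\<omega> \<in> space M. z j \<omega> = g j}" by auto
      then show "prob (z j -` {g j} \<inter> space M) = pmf p (g j)" by (simp add: prob_z)
    qed
    also have "\<dots> = prod_list (map (\<lambda>j. pmf p (g j)) L)"
      using assms(1) by (simp add: prod.distinct_set_conv_list)
    also have "map (\<lambda>j. pmf p (g j)) L = map (pmf p) w" by (simp add: g[symmetric])
    finally show ?thesis .
  qed
qed

lemma prob_word:
  assumes "distinct L"
  shows "prob {\<omega> \<in> space M. P (map (path \<omega>) L)} =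
    measure (replicate_pmf (length L) p) {w. P w}"
proof -
  let ?S = "{w. length w = length L \<and> P w}"
  have fin: "finite ?S"
    by (rule finite_subset[OF _ finite_lists_length_eq[OF finite_item, of "length L"]]) auto
  have ev: "{\<omega> \<in> space M. map (path \<omega>) L = w} \<in> events" for w
    by (rule events_word)
  have "{\<omega> \<in> space M. P (map (path \<omega>) L)} = (\<Union>w\<in>?S. {\<omega> \<in> space M. map (path \<omega>) L = w})"
    by auto
  also have "prob \<dots> = (\<Sum>w\<in>?S. prob {\<omega> \<in> space M. map (path \<omega>) L = w})"
    using fin by (intro finite_measure_finite_Union) (auto simp: disjoint_family_on_def ev)
  also have "\<dots> = (\<Sum>w\<in>?S. pmf (replicate_pmf (length L) p) w)"
    by (intro sum.cong refl) (simp add: prob_word_eq[OF assms] pmf_replicate_pmf)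
  also have "\<dots> = measure (replicate_pmf (length L) p) ?S"
    using fin by (simp add: measure_measure_pmf_finite)
  also have "\<dots> = measure (replicate_pmf (length L) p) {w. P w}"
    by (intro measure_pmf.finite_measure_eq_AE)
       (auto simp: AE_measure_pmf_iff set_replicate_pmf)
  finally show ?thesis .
qed

lemma pred_empty_at_path [measurable]: "Measurable.pred M (\<lambda>\<omega>. empty_at G (path \<omega>) N)"
  by (rule pred_empty_at) simp

text \<open>Independence is applied only to finite blocks: emptiness from depth \<open>d\<close> and
  the word after \<open>N\<close> concern disjoint sets of positions, which gives the bound for each
  \<open>d\<close>. The events decrease with \<open>d\<close>, since a longer past leaves a longer
  queue, and the bound does not depend on \<open>d\<close>.\<close>

lemma prob_empty_at_word:
  "\<exists>\<epsilon>>0. \<forall>N w. prob {\<omega> \<in> space M. empty_at G (path \<omega>) N \<and> map (path \<omega>) [N+1..N + int (length w)] = w}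
    \<ge> \<epsilon> * pmf (replicate_pmf (length w) p) w"
proof -
  obtain \<epsilon> where \<epsilon>: "\<epsilon> > 0"
    "\<And>n. measure (replicate_pmf n p) {v. foldl (serve G) [] v = []} \<ge> \<epsilon>"
    using queue_empty_bound by blast
  have "prob {\<omega> \<in> space M. empty_at G (path \<omega>) N \<and> map (path \<omega>) [N+1..N + int (length w)] = w}
    \<ge> \<epsilon> * pmf (replicate_pmf (length w) p) w" for N w
  proof -
    let ?n = "length w"
    define B where "B d = {\<omega> \<in> space M. queue_from G (path \<omega>) (N - int d) N = [] \<and>
        map (path \<omega>) [N+1..N + int ?n] = w}" for d :: nat
    have B_eq: "B d = {\<omega> \<in> space M. foldl (serve G) [] (take d (map (path \<omega>) [N - int d + 1..N + int ?n])) = [] \<and>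
        drop d (map (path \<omega>) [N - int d + 1..N + int ?n]) = w}" for d
    proof -
      have "[N - int d + 1..N + int ?n] = [N - int d + 1..N] @ [N + 1..N + int ?n]"
        using upto_split1[of "N - int d + 1" "N + 1" "N + int ?n"] by (cases "w = []") (auto simp: Suc_le_eq)
      then show ?thesis by (simp add: B_def queue_from_def)
    qed
    have B_events: "B d \<in> events" for d
      unfolding B_eq
      by (rule events_word[where P = "\<lambda>v. foldl (serve G) [] (take d v) = [] \<and> drop d v = w"])
    have B_prob: "prob (B d) \<ge> \<epsilon> * pmf (replicate_pmf ?n p) w" for d
    proof -
      let ?P = "pair_pmf (replicate_pmf d p) (replicate_pmf ?n p)"
      let ?Q = "\<lambda>v. foldl (serve G) [] (take d v) = [] \<and> drop d v = w"
      have rep: "replicate_pmf (d + ?n) p = map_pmf (\<lambda>(xs, ys). xs @ ys) ?P"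
        unfolding replicate_pmf_distrib
        by (simp add: pair_pmf_def map_bind_pmf map_pmf_def bind_assoc_pmf bind_return_pmf)
      have "length [N - int d + 1..N + int ?n] = d + ?n" by simp
      then have "prob (B d) = measure (replicate_pmf (d + ?n) p) {v. ?Q v}"
        unfolding B_eq using prob_word[OF distinct_upto, of ?Q "N - int d + 1" "N + int ?n"] by simp
      also have "\<dots> = measure ?P {(xs, ys). ?Q (xs @ ys)}"
        unfolding rep by (simp add: vimage_def case_prod_unfold)
      \<comment> \<open>The inclusion holds on the support, where the first block has length
        \<open>d\<close> and \<open>take d\<close>, \<open>drop d\<close> separate the
        blocks.\<close>
      also have "\<dots> \<ge> measure ?P ({v. foldl (serve G) [] v = []} \<times> {w})"
        by (intro measure_pmf.finite_measure_mono_AE)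
           (auto simp: AE_measure_pmf_iff set_replicate_pmf)
      also have "measure ?P ({v. foldl (serve G) [] v = []} \<times> {w}) =
          measure (replicate_pmf d p) {v. foldl (serve G) [] v = []} * pmf (replicate_pmf ?n p) w"
        by (subst measure_pmf_prob_product)
           (auto simp: measure_pmf_single countable_words)
      finally show ?thesis
        using \<epsilon>(2)[of d] by (meson mult_right_mono order_trans pmf_nonneg)
    qed
    have "decseq B"
    proof (rule decseq_SucI)
      fix d
      show "B (Suc d) \<subseteq> B d"
        unfolding B_def using queue_from_antimono[of G _ "N - int (Suc d)" N "N - int d"] by auto
    qed
    then have "(\<lambda>d. prob (B d)) \<longlonglongrightarrow> prob (\<Inter>d. B d)"
      using B_events by (intro finite_Lim_measure_decseq) auto
    then have "prob (\<Inter>d. B d) \<ge> \<epsilon> * pmf (replicate_pmf ?n p) w"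
      by (rule LIMSEQ_le_const) (use B_prob in auto)
    also have "(\<Inter>d. B d) = {\<omega> \<in> space M. empty_at G (path \<omega>) N \<and> map (path \<omega>) [N+1..N + int ?n] = w}"
      by (auto simp: B_def empty_at_iff)
    finally show ?thesis .
  qed
  with \<epsilon>(1) show ?thesis by blast
qed

lemma prob_early: "prob {\<omega> \<in> space M. \<forall>K. \<exists>N\<le>K. empty_at G (path \<omega>) N} = 1"
proof -
  define X where "X = {\<omega> \<in> space M. \<forall>K. \<exists>N\<le>K. empty_at G (path \<omega>) N}"
  \<comment> \<open>The 0-1 law is about sequences indexed by naturals, so the past is read
    backwards: the tail is the infinitely remote past.\<close>
  define F where "F i = {z (- int i) -` A \<inter> space M | A. A \<in> sets (count_space UNIV)}" for i
  have sigma: "sigma_algebra (space M) (F i)" for i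
  proof -
    have "F i = sets (vimage_algebra (space M) (z (- int i)) (count_space UNIV))"
      by (subst sets_vimage_algebra2) (auto simp: F_def)
    then show ?thesis
      using sets.sigma_algebra_axioms[of "vimage_algebra (space M) (z (- int i)) (count_space UNIV)"]
      by simp
  qed
  have "inj (\<lambda>i::nat. - int i)" by (auto simp: inj_on_def)
  then have indepF: "indep_sets F UNIV"
    using indep_vars_reindex[OF _ indep] unfolding indep_vars_def2 F_def by blast
  have tail: "X \<in> tail_events F"
    unfolding tail_events_def
  proof
    fix n
    define T where "T = sigma (space M) (\<Union> (F ` {n..}))"
    have sub: "\<Union> (F ` {n..}) \<subseteq> Pow (space M)" by (auto simp: F_def)
    have T: "space T = space M" "sets T = sigma_sets (space M) (\<Union> (F ` {n..}))"
      using sub by (simp_all add: T_def)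
    have zT: "Measurable.pred T (\<lambda>\<omega>. z m \<omega> = i)" if m: "m \<le> - int n" for m i
    proof -
      have "z m -` {i} \<inter> space M \<in> F (nat (- m))"
        using m unfolding F_def by (intro CollectI exI[of _ "{i}"]) simp
      moreover have "nat (- m) \<in> {n..}" using m by simp
      moreover have "{\<omega> \<in> space M. z m \<omega> = i} = z m -` {i} \<inter> space M" by auto
      ultimately show ?thesis
        unfolding pred_def T by (intro sigma_sets.Basic) auto
    qed
    have [measurable]: "Measurable.pred T (\<lambda>\<omega>. empty_at G (path \<omega>) (- int n - int k - int j))" for k j
      by (rule pred_empty_at) (use zT in auto)
    have "Measurable.pred T (\<lambda>\<omega>. \<forall>K. \<exists>N\<le>K. empty_at G (path \<omega>) N)"
      unfolding early_iff[of _ n] by measurable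
    then show "X \<in> sigma_sets (space M) (\<Union> (F ` {n..}))"
      unfolding pred_def T X_def .
  qed
  obtain \<epsilon> where \<epsilon>: "\<epsilon> > 0"
    "\<And>N w. prob {\<omega> \<in> space M. empty_at G (path \<omega>) N \<and> map (path \<omega>) [N+1..N + int (length w)] = w}
      \<ge> \<epsilon> * pmf (replicate_pmf (length w) p) w"
    using prob_empty_at_word by blast
  \<comment> \<open>Each of these events contains a single emptiness event of probability at least
    \<open>\<epsilon>\<close>. Their decreasing limit \<open>X\<close> inherits the bound, which
    excludes the value 0.\<close>
  define B where "B k = {\<omega> \<in> space M. \<exists>N\<le>- int k. empty_at G (path \<omega>) N}" for k :: nat
  have B_events: "B k \<in> events" for k unfolding B_def by measurable
  have "prob (B k) \<ge> \<epsilon>" for k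
  proof -
    have "\<epsilon> \<le> prob {\<omega> \<in> space M. empty_at G (path \<omega>) (- int k)}"
      using \<epsilon>(2)[of "[]" "- int k"] by simp
    also have "\<dots> \<le> prob (B k)"
      by (intro finite_measure_mono B_events) (auto simp: B_def)
    finally show ?thesis .
  qed
  moreover have "decseq B"
    unfolding B_def
  proof (rule decseq_SucI, safe)
    fix k \<omega> N assume "N \<le> - int (Suc k)" "empty_at G (path \<omega>) N"
    then show "\<exists>N\<le>- int k. empty_at G (path \<omega>) N" by (intro exI[of _ N]) simp
  qed
  then have "(\<lambda>k. prob (B k)) \<longlonglongrightarrow> prob (\<Inter>k. B k)"
    using B_events by (intro finite_Lim_measure_decseq) auto
  ultimately have "prob (\<Inter>k. B k) \<ge> \<epsilon>"
    by (intro LIMSEQ_le_const) auto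
  also have "(\<Inter>k. B k) = X"
  proof (intro set_eqI iffI)
    fix \<omega> assume "\<omega> \<in> (\<Inter>k. B k)"
    then have \<omega>: "\<omega> \<in> space M" "\<And>k. \<exists>N\<le>- int k. empty_at G (path \<omega>) N"
      by (auto simp: B_def)
    have "\<exists>N\<le>K. empty_at G (path \<omega>) N" for K
    proof -
      obtain N where "N \<le> - int (nat (- K))" "empty_at G (path \<omega>) N" using \<omega>(2) by blast
      moreover from this(1) have "N \<le> K" by (cases "K \<le> 0") auto
      ultimately show ?thesis by blast
    qed
    with \<omega>(1) show "\<omega> \<in> X" by (simp add: X_def)
  qed (auto simp: X_def B_def)
  finally show ?thesis
    using kolmogorov_0_1_law[OF sigma indepF tail] \<epsilon>(1) by (auto simp: X_def)
qed

section \<open>Shift invariance of the law of the sequence\<close>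

abbreviation seq_space :: "(int \<Rightarrow> ('c, 's) item) measure" where
  "seq_space \<equiv> (\<Pi>\<^sub>M n\<in>UNIV. count_space UNIV)"

lemma pred_coord [measurable]: "Measurable.pred seq_space (\<lambda>x. x n = i)"
  by measurable

lemma shift_path_measurable [measurable]: "(\<lambda>\<omega>. shift k (path \<omega>)) \<in> M \<rightarrow>\<^sub>M seq_space"
  unfolding shift_def by (rule measurable_PiM_single') auto

lemma distr_shift_path:
  "distr M seq_space (\<lambda>\<omega>. shift k (path \<omega>)) = (\<Pi>\<^sub>M n\<in>UNIV. measure_pmf p)"
proof -
  have "indep_vars (\<lambda>_. count_space UNIV) (\<lambda>n. z (n + k)) UNIV"
    by (rule indep_vars_reindex[OF _ indep]) (auto simp: inj_on_def)
  then have "distr M seq_space (\<lambda>\<omega>. \<lambda>n\<in>UNIV. z (n + k) \<omega>) =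
      (\<Pi>\<^sub>M n\<in>UNIV. distr M (count_space UNIV) (z (n + k)))"
    by (subst (asm) indep_vars_iff_distr_eq_PiM) auto
  moreover have "distr M (count_space UNIV) (z n) = measure_pmf p" for n
  proof (rule measure_eqI_countable[of _ UNIV])
    show "countable (UNIV :: ('c, 's) item set)"
      using finite_item by (rule countable_finite)
    fix i
    have "z n -` {i} \<inter> space M = {\<omega> \<in> space M. z n \<omega> = i}" by auto
    then show "emeasure (distr M (count_space UNIV) (z n)) {i} = emeasure (measure_pmf p) {i}"
      by (simp add: emeasure_distr emeasure_eq_measure prob_z emeasure_pmf_single)
  qed auto
  ultimately show ?thesis unfolding shift_def restrict_UNIV by simp
qed

lemma prob_shift:
  assumes "Measurable.pred seq_space P"
  shows "prob {\<omega> \<in> space M. P (shift k (path \<omega>))} = prob {\<omega> \<in> space M. P (path \<omega>)}"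
proof -
  have *: "prob {\<omega> \<in> space M. P (shift j (path \<omega>))} =
      measure (\<Pi>\<^sub>M n\<in>UNIV. measure_pmf p) {x \<in> space seq_space. P x}" for j
  proof -
    have "shift j (path \<omega>) \<in> space seq_space" for \<omega> by (simp add: space_PiM)
    then have "{\<omega> \<in> space M. P (shift j (path \<omega>))} =
        (\<lambda>\<omega>. shift j (path \<omega>)) -` {x \<in> space seq_space. P x} \<inter> space M" by auto
    then show ?thesis
      using assms unfolding distr_shift_path[of j, symmetric]
      by (subst measure_distr) (auto simp: pred_def)
  qed
  have "shift 0 x = x" for x :: "int \<Rightarrow> ('c, 's) item" by (simp add: shift_def)
  with *[of k] *[of 0] show ?thesis by simp
qed

text \<open>By shift invariance \<open>prob (L K)\<close> does not depend on \<open>K\<close>. As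
  \<open>K\<close> decreases, the events \<open>L K\<close> increase to one that contains the almost
  sure event \<open>E\<close> of early regenerations, so the common value is 1.\<close>

lemma AE_regenerative: "AE \<omega> in M. regenerative G (path \<omega>)"
proof -
  define E where "E = {\<omega> \<in> space M. \<forall>K. \<exists>N\<le>K. empty_at G (path \<omega>) N}"
  define L where "L K = {\<omega> \<in> space M. \<exists>N\<ge>K. empty_at G (path \<omega>) N}" for K
  have E_events: "E \<in> events" unfolding E_def by measurable
  have L_events: "L K \<in> events" for K unfolding L_def by measurable
  have [measurable]: "Measurable.pred seq_space (\<lambda>x. empty_at G x N)" for N
    using pred_empty_at[where n = N and N = seq_space and y = "\<lambda>m x. x m" and G = G] pred_coord by simp
  have L_const: "prob (L K) = prob (L 0)" for K
  proof -
    have "(\<exists>N\<ge>K. empty_at G x N) \<longleftrightarrow> (\<exists>N\<ge>0. empty_at G (shift K x) N)" for x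
    proof safe
      fix N assume "K \<le> N" "empty_at G x N"
      then show "\<exists>N\<ge>0. empty_at G (shift K x) N"
        by (intro exI[of _ "N - K"]) (simp add: empty_at_shift)
    next
      fix N :: int assume "0 \<le> N" "empty_at G (shift K x) N"
      then show "\<exists>N\<ge>K. empty_at G x N"
        by (intro exI[of _ "N + K"]) (simp add: empty_at_shift)
    qed
    then show ?thesis
      unfolding L_def using prob_shift[of "\<lambda>x. \<exists>N\<ge>0. empty_at G x N" K] by simp
  qed
  have "incseq (\<lambda>j. L (- int j))"
    unfolding L_def
  proof (rule incseq_SucI, safe)
    fix j \<omega> N assume "- int j \<le> N" "empty_at G (path \<omega>) N"
    then show "\<exists>N\<ge>- int (Suc j). empty_at G (path \<omega>) N" by (intro exI[of _ N]) simp
  qed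
  then have "(\<lambda>j. prob (L (- int j))) \<longlonglongrightarrow> prob (\<Union>j. L (- int j))"
    using L_events by (intro finite_Lim_measure_incseq) auto
  moreover have "(\<lambda>j. prob (L (- int j))) = (\<lambda>_. prob (L 0))"
    by (rule ext) (rule L_const)
  ultimately have "prob (\<Union>j. L (- int j)) = prob (L 0)"
    by (simp add: LIMSEQ_const_iff)
  moreover have "E \<subseteq> (\<Union>j. L (- int j))"
  proof
    fix \<omega> assume \<omega>: "\<omega> \<in> E"
    then obtain N where N: "N \<le> 0" "empty_at G (path \<omega>) N" unfolding E_def by blast
    then have "- int (nat (- N)) \<le> N" by simp
    moreover have "\<omega> \<in> space M" using \<omega> unfolding E_def by blast
    ultimately have "\<omega> \<in> L (- int (nat (- N)))" using N(2) unfolding L_def by blast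
    then show "\<omega> \<in> (\<Union>j. L (- int j))" by blast
  qed
  then have "prob E \<le> prob (\<Union>j. L (- int j))"
    using L_events by (intro finite_measure_mono) auto
  moreover have "prob E = 1" unfolding E_def by (rule prob_early)
  ultimately have "prob (L K) = 1" for K
    using L_const[of K] prob_le_1[of "L 0"] by simp
  then have "AE \<omega> in M. \<omega> \<in> L K" for K
    using L_events by (simp add: prob_eq_1)
  then have "AE \<omega> in M. \<forall>K. \<omega> \<in> L K"
    by (subst AE_all_countable) simp
  moreover have "AE \<omega> in M. \<omega> \<in> E"
    using E_events \<open>prob E = 1\<close> by (simp add: prob_eq_1)
  ultimately show ?thesis
    unfolding regenerative_def E_def L_def by eventually_elim blast
qed

end

section \<open>Stationary processes determined by a window between two regenerations\<close>

lemma measurable_completion_AE: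
  assumes f: "f \<in> space M \<rightarrow> space N" and g: "g \<in> M \<rightarrow>\<^sub>M N" and "AE x in M. f x = g x"
  shows "f \<in> completion M \<rightarrow>\<^sub>M N"
proof (rule measurableI)
  fix A assume A: "A \<in> sets N"
  obtain E where E: "{x \<in> space M. f x \<noteq> g x} \<subseteq> E" "E \<in> null_sets M"
    using assms(3) unfolding eventually_ae_filter by blast
  have eq: "f -` A \<inter> space (completion M) = (g -` A \<inter> space M - E) \<union> (f -` A \<inter> space M \<inter> E)"
    using E(1) by auto
  have "f -` A \<inter> space M \<inter> E \<in> sets (completion M)"
    using E(2) by (intro sets_completionI_sub) auto
  moreover have "g -` A \<inter> space M - E \<in> sets (completion M)"
    using measurable_sets[OF g A] E(2) by (intro sets_completionI_sets sets.Diff) auto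
  ultimately show "f -` A \<inter> space (completion M) \<in> sets (completion M)"
    unfolding eq by (intro sets.Un)
qed (use f in auto)

lemma distr_completion_AE:
  assumes "f \<in> space M \<rightarrow> space N" "g \<in> M \<rightarrow>\<^sub>M N" "AE x in M. f x = g x"
  shows "distr (completion M) N f = distr M N g"
proof -
  have "distr (completion M) N f = distr (completion M) N g"
    by (rule distr_cong_AE)
       (use assms AE_completion measurable_completion measurable_completion_AE[OF assms] in auto)
  then show ?thesis using assms(2) by (simp add: distr_completion)
qed

text \<open>The points of \<open>Y\<close> without mass form a countable union of null sets. The
  type of states is arbitrary, so countability enters only through the set of possible
  values.\<close>

lemma pmf_of_countable_range:
  assumes "prob_space D" "sets D = UNIV" "AE x in D. x \<in> Y" "countable Y"
  shows "\<exists>\<pi>. measure_pmf \<pi> = D"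
proof -
  interpret prob_space D by fact
  have "AE x in D. \<forall>y\<in>Y. measure D {y} = 0 \<longrightarrow> x \<noteq> y"
  proof (subst AE_ball_countable[OF assms(4)], safe)
    fix y
    show "AE x in D. measure D {y} = 0 \<longrightarrow> x \<noteq> y"
    proof (cases "measure D {y} = 0")
      case True
      then have "{y} \<in> null_sets D"
        using assms(2) by (auto simp: null_sets_def emeasure_eq_measure)
      then show ?thesis by (rule AE_I') auto
    qed simp
  qed
  with assms(3) have "AE x in D. measure D {x} \<noteq> 0"
    by eventually_elim auto
  then have "measure_pmf (Abs_pmf D) = D"
    using assms(1,2) by (intro Abs_pmf_inverse) auto
  then show ?thesis by blast
qed

context fcfs_process
begin

text \<open>No measurable choice of regenerations is needed: every admissible pair gives the same
  value of \<open>g\<close>, so it suffices to say that some pair gives a value in \<open>A\<close>,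
  a countable union. The constant \<open>undefined\<close> replaces the uncontrolled values off the
  regenerative event.\<close>

lemma window_process_measurable:
  fixes F :: "(int \<Rightarrow> ('c, 's) item) \<Rightarrow> int \<Rightarrow> 'e"
    and g :: "('c, 's) item list \<Rightarrow> ('c, 's) item list \<Rightarrow> 'e"
  assumes window: "\<And>x N0 N N1. regenerative G x \<Longrightarrow> empty_at G x N0 \<Longrightarrow> N0 \<le> N \<Longrightarrow> N \<le> N1 \<Longrightarrow>
      empty_at G x N1 \<Longrightarrow> F x N = g (map x [N0+1..N]) (map x [N+1..N1])"
  shows "(\<lambda>x. if regenerative G x then F x N else undefined) \<in> seq_space \<rightarrow>\<^sub>M count_space UNIV"
proof (rule measurableI)
  fix A :: "'e set"
  let ?F = "\<lambda>x. if regenerative G x then F x N else undefined"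
  let ?Q = "\<lambda>x. (regenerative G x \<and> (\<exists>N0 N1. N0 \<le> N \<and> N \<le> N1 \<and> empty_at G x N0 \<and> empty_at G x N1 \<and>
        g (map x [N0+1..N]) (map x [N+1..N1]) \<in> A)) \<or> (\<not> regenerative G x \<and> undefined \<in> A)"
  have "?F x \<in> A \<longleftrightarrow> ?Q x" for x
  proof (cases "regenerative G x")
    case True
    obtain N0 N1 where N: "N0 \<le> N" "empty_at G x N0" "N \<le> N1" "empty_at G x N1"
      using regenerative_early[OF True] regenerative_late[OF True] by blast
    show ?thesis
    proof
      assume "?F x \<in> A"
      then show "?Q x" using window[OF True N(2,1,3,4)] N True by auto
    next
      assume "?Q x"
      then obtain N0 N1 where "N0 \<le> N" "N \<le> N1" "empty_at G x N0" "empty_at G x N1"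
        "g (map x [N0+1..N]) (map x [N+1..N1]) \<in> A"
        using True by blast
      then show "?F x \<in> A" using window[OF True, of N0 N N1] True by simp
    qed
  qed simp
  then have eq: "?F -` A \<inter> space seq_space = {x \<in> space seq_space. ?Q x}" by auto
  have [measurable]: "Measurable.pred seq_space (\<lambda>x. empty_at G x n)" for n
    using pred_empty_at[where n = n and N = seq_space and y = "\<lambda>m x. x m" and G = G] pred_coord
    by simp
  have [measurable]: "Measurable.pred seq_space (\<lambda>x. regenerative G x)"
    using pred_regenerative[where N = seq_space and y = "\<lambda>m x. x m" and G = G] pred_coord by simp
  have [measurable]: "Measurable.pred seq_space (\<lambda>x. g (map x [N0+1..N]) (map x [N+1..N1]) \<in> A)" for N0 N1
  proof -
    let ?P = "\<lambda>v. g (take (nat (N - N0)) v) (drop (nat (N - N0)) v) \<in> A"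
    have "Measurable.pred seq_space (\<lambda>x. ?P (map (\<lambda>m. x m) ([N0+1..N] @ [N+1..N1])))"
      by (rule pred_map_word) (rule pred_coord)
    then show ?thesis by simp
  qed
  show "?F -` A \<inter> space seq_space \<in> sets seq_space"
    unfolding eq by measurable
qed simp

text \<open>\<open>g\<close> sees words without their positions, and regenerations move along with
  the shift.\<close>

lemma window_process_shift:
  fixes F :: "(int \<Rightarrow> ('c, 's) item) \<Rightarrow> int \<Rightarrow> 'e"
    and g :: "('c, 's) item list \<Rightarrow> ('c, 's) item list \<Rightarrow> 'e"
  assumes window: "\<And>x N0 N N1. regenerative G x \<Longrightarrow> empty_at G x N0 \<Longrightarrow> N0 \<le> N \<Longrightarrow> N \<le> N1 \<Longrightarrow>
      empty_at G x N1 \<Longrightarrow> F x N = g (map x [N0+1..N]) (map x [N+1..N1])"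
    and x: "regenerative G x"
  shows "regenerative G (shift k x)" "F (shift k x) N = F x (N + k)"
proof -
  show reg: "regenerative G (shift k x)"
    unfolding regenerative_def empty_at_shift
  proof safe
    fix K
    obtain N where "N \<le> K + k" "empty_at G x N" using regenerative_early[OF x] by blast
    then show "\<exists>N\<le>K. empty_at G x (N + k)" by (intro exI[of _ "N - k"]) simp
  next
    fix K
    obtain N where "N \<ge> K + k" "empty_at G x N" using regenerative_late[OF x] by blast
    then show "\<exists>N\<ge>K. empty_at G x (N + k)" by (intro exI[of _ "N - k"]) simp
  qed
  obtain N0 N1 where N: "N0 \<le> N" "empty_at G (shift k x) N0" "N \<le> N1" "empty_at G (shift k x) N1"
    using regenerative_early[OF reg] regenerative_late[OF reg] by blast
  have "F (shift k x) N = g (map (shift k x) [N0+1..N]) (map (shift k x) [N+1..N1])"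
    by (rule window) (use reg N in auto)
  also have "\<dots> = g (map x [(N0 + k)+1..N + k]) (map x [(N + k)+1..N1 + k])"
    by (simp add: map_shift algebra_simps)
  also have "\<dots> = F x (N + k)"
    by (rule window[symmetric]) (use x N in \<open>auto simp: empty_at_shift\<close>)
  finally show "F (shift k x) N = F x (N + k)" .
qed

text \<open>The last two conclusions are the halves of a positivity criterion. A state of positive
  probability occurs on some regenerative path and so is a value of \<open>g\<close>; conversely, a
  regeneration followed by \<open>a @ b\<close> has positive probability. The converse asks for no
  regeneration at the right end, so the word may stop as soon as the state is determined.\<close>

lemma window_process_stationary:
  fixes F :: "(int \<Rightarrow> ('c, 's) item) \<Rightarrow> int \<Rightarrow> 'e"
    and g :: "('c, 's) item list \<Rightarrow> ('c, 's) item list \<Rightarrow> 'e"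
  assumes window: "\<And>x N0 N N1. regenerative G x \<Longrightarrow> empty_at G x N0 \<Longrightarrow> N0 \<le> N \<Longrightarrow> N \<le> N1 \<Longrightarrow>
      empty_at G x N1 \<Longrightarrow> F x N = g (map x [N0+1..N]) (map x [N+1..N1])"
  obtains \<pi> where "stationary_distribution (completion M) (\<lambda>N \<omega>. F (path \<omega>) N) \<pi>"
    "\<And>u. pmf \<pi> u > 0 \<Longrightarrow> \<exists>a b. u = g a b"
    "\<And>u a b. (\<And>x. regenerative G x \<Longrightarrow> empty_at G x (- int (length a)) \<Longrightarrow>
        map x [- int (length a) + 1..0] = a \<Longrightarrow> map x [1..int (length b)] = b \<Longrightarrow> F x 0 = u) \<Longrightarrow>
      pmf \<pi> u > 0"
proof -
  define H where "H N x = (if regenerative G x then F x N else undefined)" for N x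
  let ?S = "\<Pi>\<^sub>M n\<in>(UNIV :: int set). count_space (UNIV :: 'e set)"
  let ?P = "\<Pi>\<^sub>M n\<in>(UNIV :: int set). measure_pmf p"
  note shift_F = window_process_shift[of F g, OF window]
  have H_meas [measurable]: "H N \<in> seq_space \<rightarrow>\<^sub>M count_space UNIV" for N
    unfolding H_def[abs_def] by (rule window_process_measurable) (rule window)
  have path_meas [measurable]: "path \<in> M \<rightarrow>\<^sub>M seq_space"
    by (rule measurable_PiM_single') auto
  have all_meas: "(\<lambda>x N. H N x) \<in> seq_space \<rightarrow>\<^sub>M ?S"
    by (rule measurable_PiM_single') auto
  have AE_H: "AE \<omega> in M. \<forall>N. F (path \<omega>) (N + k) = H N (shift k (path \<omega>))" for k
    using AE_regenerative by eventually_elim (simp add: H_def shift_F)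
  have AE_H1: "AE \<omega> in M. F (path \<omega>) k = H 0 (shift k (path \<omega>))" for k
    using AE_H[of k] by eventually_elim (metis add_0)
  have H_shift: "(\<lambda>\<omega>. H N (shift k (path \<omega>))) \<in> M \<rightarrow>\<^sub>M count_space UNIV" for N k
    by (rule measurable_compose[OF shift_path_measurable H_meas])
  have law: "distr (completion M) (count_space UNIV) (\<lambda>\<omega>. F (path \<omega>) k) =
      distr ?P (count_space UNIV) (H 0)" for k
  proof -
    have "distr (completion M) (count_space UNIV) (\<lambda>\<omega>. F (path \<omega>) k) =
        distr M (count_space UNIV) (\<lambda>\<omega>. H 0 (shift k (path \<omega>)))"
      by (rule distr_completion_AE[OF _ H_shift AE_H1]) simp
    also have "\<dots> = distr (distr M seq_space (\<lambda>\<omega>. shift k (path \<omega>))) (count_space UNIV) (H 0)"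
      by (subst distr_distr[OF H_meas shift_path_measurable]) (simp add: comp_def)
    finally show ?thesis by (simp add: distr_shift_path)
  qed
  have law_all: "distr (completion M) ?S (\<lambda>\<omega> N. F (path \<omega>) (N + k)) =
      distr ?P ?S (\<lambda>x N. H N x)" for k
  proof -
    have "distr (completion M) ?S (\<lambda>\<omega> N. F (path \<omega>) (N + k)) =
        distr M ?S (\<lambda>\<omega> N. H N (shift k (path \<omega>)))"
    proof (rule distr_completion_AE)
      show "(\<lambda>\<omega> N. H N (shift k (path \<omega>))) \<in> M \<rightarrow>\<^sub>M ?S"
        using measurable_compose[OF shift_path_measurable all_meas] by simp
      show "AE \<omega> in M. (\<lambda>N. F (path \<omega>) (N + k)) = (\<lambda>N. H N (shift k (path \<omega>)))"
        using AE_H[of k] by eventually_elim auto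
    qed (auto simp: space_PiM)
    also have "\<dots> = distr (distr M seq_space (\<lambda>\<omega>. shift k (path \<omega>))) ?S (\<lambda>x N. H N x)"
      by (subst distr_distr[OF all_meas shift_path_measurable]) (simp add: comp_def)
    finally show ?thesis by (simp add: distr_shift_path)
  qed
  define D where "D = distr M (count_space UNIV) (\<lambda>\<omega>. H 0 (path \<omega>))"
  have H0: "(\<lambda>\<omega>. H 0 (path \<omega>)) \<in> M \<rightarrow>\<^sub>M count_space UNIV"
    using H_shift[of 0 0] by (simp add: shift_def)
  have "AE \<omega> in M. F (path \<omega>) 0 = H 0 (path \<omega>)"
    using AE_H1[of 0] by (simp add: shift_def)
  then have D: "D = distr (completion M) (count_space UNIV) (\<lambda>\<omega>. F (path \<omega>) 0)"
    unfolding D_def by (intro distr_completion_AE[symmetric] H0) auto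
  let ?Y = "range (\<lambda>(a, b). g a b)"
  have H_range: "H 0 x \<in> ?Y" if x: "regenerative G x" for x
  proof -
    obtain N0 N1 where N: "N0 \<le> 0" "empty_at G x N0" "0 \<le> N1" "empty_at G x N1"
      using regenerative_early[OF x] regenerative_late[OF x] by blast
    have "H 0 x = g (map x [N0+1..0]) (map x [0+1..N1])"
      using window[OF x N(2,1,3,4)] x by (simp add: H_def)
    then show ?thesis by auto
  qed
  have "AE x in D. x \<in> ?Y"
    unfolding D_def
    using AE_regenerative H_range by (subst AE_distr_iff[OF H0]) auto
  moreover have "countable ?Y"
  proof (rule countable_image)
    show "countable (UNIV :: (('c, 's) item list \<times> ('c, 's) item list) set)"
      using countable_words[of UNIV] countable_SIGMA[of UNIV "\<lambda>_. UNIV"] by simp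
  qed
  moreover have "prob_space D" unfolding D_def by (rule prob_space_distr[OF H0])
  ultimately obtain \<pi> where \<pi>: "measure_pmf \<pi> = D"
    using pmf_of_countable_range[of D ?Y] by (auto simp: D_def)
  have pmf_eq: "pmf \<pi> u = prob {\<omega> \<in> space M. H 0 (path \<omega>) = u}" for u
  proof -
    have "(\<lambda>\<omega>. H 0 (path \<omega>)) -` {u} \<inter> space M = {\<omega> \<in> space M. H 0 (path \<omega>) = u}" by auto
    then show ?thesis
      unfolding pmf.rep_eq \<pi> D_def by (subst measure_distr[OF H0]) auto
  qed
  have ev: "{\<omega> \<in> space M. H 0 (path \<omega>) = u} \<in> events" for u
    using measurable_sets[OF H0, of "{u}"] by (simp add: vimage_def Int_def conj_commute)
  show thesis
  proof (rule that)
    show "stationary_distribution (completion M) (\<lambda>N \<omega>. F (path \<omega>) N) \<pi>"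
      unfolding stationary_distribution_def
    proof (intro conjI allI)
      show "(\<lambda>\<omega>. F (path \<omega>) n) \<in> completion M \<rightarrow>\<^sub>M count_space UNIV" for n
        by (rule measurable_completion_AE[OF _ H_shift AE_H1]) simp
      show "distr (completion M) ?S (\<lambda>\<omega> n. F (path \<omega>) (n + k)) =
          distr (completion M) ?S (\<lambda>\<omega> n. F (path \<omega>) n)" for k
        using law_all[of k] law_all[of 0] by simp
      show "distr (completion M) (count_space UNIV) (\<lambda>\<omega>. F (path \<omega>) n) = measure_pmf \<pi>" for n
        unfolding \<pi> D law[of n] law[of 0] ..
    qed
  next
    fix u assume "pmf \<pi> u > 0"
    then have pos: "prob {\<omega> \<in> space M. H 0 (path \<omega>) = u} > 0" by (simp add: pmf_eq)
    have "\<exists>\<omega>\<in>space M. regenerative G (path \<omega>) \<and> H 0 (path \<omega>) = u"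
    proof (rule ccontr)
      assume none: "\<not> ?thesis"
      have "AE \<omega> in M. H 0 (path \<omega>) \<noteq> u"
        using AE_regenerative AE_space by eventually_elim (use none in auto)
      then have "prob {\<omega> \<in> space M. H 0 (path \<omega>) = u} = 0"
        using ev by (subst prob_eq_0) auto
      with pos show False by simp
    qed
    then show "\<exists>a b. u = g a b" using H_range by fastforce
  next
    fix u a b
    assume u: "\<And>x. regenerative G x \<Longrightarrow> empty_at G x (- int (length a)) \<Longrightarrow>
        map x [- int (length a) + 1..0] = a \<Longrightarrow> map x [1..int (length b)] = b \<Longrightarrow> F x 0 = u"
    obtain \<epsilon> where \<epsilon>: "\<epsilon> > 0"
      "\<And>N w. prob {\<omega> \<in> space M. empty_at G (path \<omega>) N \<and> map (path \<omega>) [N+1..N + int (length w)] = w}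
        \<ge> \<epsilon> * pmf (replicate_pmf (length w) p) w"
      using prob_empty_at_word by blast
    let ?w = "a @ b"
    let ?N = "- int (length a)"
    let ?E = "{\<omega> \<in> space M. empty_at G (path \<omega>) ?N \<and> map (path \<omega>) [?N+1..?N + int (length ?w)] = ?w}"
    have "pmf p i \<noteq> 0" for i using pmf_pos[of i] by simp
    then have "set_pmf p = UNIV" by (simp add: set_pmf_eq)
    then have "?w \<in> set_pmf (replicate_pmf (length ?w) p)" by (simp add: set_replicate_pmf)
    then have "0 < \<epsilon> * pmf (replicate_pmf (length ?w) p) ?w"
      using \<epsilon>(1) by (simp add: pmf_positive)
    also have "\<dots> \<le> prob ?E" by (rule \<epsilon>(2))
    also have "\<dots> \<le> prob {\<omega> \<in> space M. H 0 (path \<omega>) = u}"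
    proof (rule finite_measure_mono_AE[OF _ ev])
      show "AE \<omega> in M. \<omega> \<in> ?E \<longrightarrow> \<omega> \<in> {\<omega> \<in> space M. H 0 (path \<omega>) = u}"
        using AE_regenerative
      proof eventually_elim
        case (elim \<omega>)
        show ?case
        proof
          assume \<omega>: "\<omega> \<in> ?E"
          have "[?N+1..?N + int (length ?w)] = [?N+1..0] @ [1..int (length b)]"
            using upto_split1[of "?N+1" 1 "int (length b)"] by (cases "b = []") (auto simp: Suc_le_eq)
          then have "map (path \<omega>) [?N+1..0] @ map (path \<omega>) [1..int (length b)] = a @ b"
            using \<omega> by simp
          then have "map (path \<omega>) [?N+1..0] = a" "map (path \<omega>) [1..int (length b)] = b"
            by (auto simp: append_eq_append_conv)
          then have "F (path \<omega>) 0 = u" using \<omega> elim by (intro u) auto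
          then show "\<omega> \<in> {\<omega> \<in> space M. H 0 (path \<omega>) = u}" using \<omega> elim by (simp add: H_def)
        qed
      qed
    qed
    finally show "pmf \<pi> u > 0" by (simp add: pmf_eq)
  qed
qed

end

section \<open>The states of positive probability\<close>

lemma trim_start_eq:
  assumes "u = [] \<or> plain_agent (u ! 0)"
  shows "trim_start u = u"
  using assms by (cases u) (auto simp: trim_start_def)

lemma trim_end_eq:
  assumes "u = [] \<or> exchanged_agent (u ! (length u - 1))"
  shows "trim_end u = u"
  using assms by (cases u rule: rev_cases) (auto simp: trim_end_def)

lemma trim_start_hd: "trim_start v \<noteq> [] \<Longrightarrow> plain_agent (trim_start v ! 0)"
  unfolding trim_start_def by (metis hd_conv_nth hd_dropWhile)

lemma trim_end_last: "trim_end v \<noteq> [] \<Longrightarrow> exchanged_agent (trim_end v ! (length (trim_end v) - 1))"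
  unfolding trim_end_def by (metis hd_dropWhile last_conv_nth last_rev rev_is_Nil_conv)

lemma valid_record_nth:
  "valid_record G u \<longleftrightarrow>
    (\<forall>e\<in>set u. (\<exists>c. e = Plain (Agent c)) \<or> (\<exists>c. e = Exchanged (Agent c)) \<or> (\<exists>s. e = Exchanged (Good s))) \<and>
    (\<forall>k l c s. k < l \<and> l < length u \<and> u ! k = Plain (Agent c) \<and> u ! l = Exchanged (Good s) \<longrightarrow> (s, c) \<notin> G)"
  unfolding valid_record_def sorted_wrt_iff_nth_less no_overlook_def record_entries_def by blast

lemma valid_old_record_nth:
  "valid_old_record G u \<longleftrightarrow>
    (\<forall>e\<in>set u. (\<exists>c. e = Plain (Agent c)) \<or> (\<exists>c. e = Exchanged (Agent c)) \<or> (\<exists>s. e = Plain (Good s))) \<and>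
    (\<forall>k l c s. l < k \<and> k < length u \<and> u ! k = Exchanged (Agent c) \<and> u ! l = Plain (Good s) \<longrightarrow> (s, c) \<notin> G)"
  unfolding valid_old_record_def sorted_wrt_iff_nth_less no_early_def old_record_entries_def by blast

context fcfs_process
begin

lemma U_stationary:
  "\<exists>\<pi>. stationary_distribution (completion M) (\<lambda>N \<omega>. U G (path \<omega>) N) \<pi> \<and>
    (\<forall>u. pmf \<pi> u > 0 \<longleftrightarrow> u = [] \<or> u \<noteq> [] \<and> plain_agent (u ! 0) \<and> valid_record G u)"
proof -
  let ?g = "\<lambda>a b :: ('c, 's) item list. trim_start (foldl (record_step G) [] a)"
  obtain \<pi> where \<pi>: "stationary_distribution (completion M) (\<lambda>N \<omega>. U G (path \<omega>) N) \<pi>"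
    "\<And>u. pmf \<pi> u > 0 \<Longrightarrow> \<exists>a b. u = ?g a b"
    "\<And>u a b. (\<And>x. regenerative G x \<Longrightarrow> empty_at G x (- int (length a)) \<Longrightarrow>
        map x [- int (length a) + 1..0] = a \<Longrightarrow> map x [1..int (length b)] = b \<Longrightarrow> U G x 0 = u) \<Longrightarrow>
      pmf \<pi> u > 0"
    using window_process_stationary[of "U G" ?g] U_eq_trim_start by blast
  have "pmf \<pi> u > 0 \<longleftrightarrow> u = [] \<or> u \<noteq> [] \<and> plain_agent (u ! 0) \<and> valid_record G u" for u
  proof
    assume "pmf \<pi> u > 0"
    then obtain a where u: "u = trim_start (foldl (record_step G) [] a)" using \<pi>(2) by blast
    have "valid_record G (foldl (record_step G) [] a)"
      by (rule valid_record_foldl) (simp add: valid_record_def)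
    then show "u = [] \<or> u \<noteq> [] \<and> plain_agent (u ! 0) \<and> valid_record G u"
      unfolding u using valid_record_trim_start trim_start_hd by blast
  next
    assume u: "u = [] \<or> u \<noteq> [] \<and> plain_agent (u ! 0) \<and> valid_record G u"
    then have "valid_record G u" by (auto simp: valid_record_def)
    then obtain q a where q: "\<forall>e\<in>set q. \<not> plain_agent e" "foldl (record_step G) [] a = q @ u"
      using valid_record_reachable[OF compatible_good_exists] by blast
    have eq: "trim_start (foldl (record_step G) [] a) = u"
      unfolding q(2) trim_start_append[OF q(1)] using u by (intro trim_start_eq) blast
    \<comment> \<open>The second word is empty, as \<open>U\<close> does not look at the
      future.\<close>
    show "pmf \<pi> u > 0"
    proof (rule \<pi>(3)[of a "[]"])
      fix x assume "regenerative G x" "empty_at G x (- int (length a))"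
        "map x [- int (length a) + 1..0] = a"
      then show "U G x 0 = u"
        using U_eq_trim_start[of G x "- int (length a)" 0] eq by simp
    qed
  qed
  with \<pi>(1) show ?thesis by blast
qed

lemma W_stationary:
  "\<exists>\<pi>. stationary_distribution (completion M) (\<lambda>N \<omega>. W G (path \<omega>) N) \<pi> \<and>
    (\<forall>w. pmf \<pi> w > 0 \<longleftrightarrow>
      w = [] \<or> w \<noteq> [] \<and> exchanged_agent (w ! (length w - 1)) \<and> valid_old_record G w)"
proof -
  let ?g = "\<lambda>a b. trim_end (old_entries G (foldl (serve G) [] a) b)"
  have window: "W G x N = ?g (map x [N0+1..N]) (map x [N+1..N1])"
    if "regenerative G x" "empty_at G x N0" "N0 \<le> N" "N \<le> N1" "empty_at G x N1" for x N0 N N1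
    using W_eq_trim_end[OF that(1-4) old_queue_empty_at[OF that(1-3,5,4)]]
    by (simp add: queue_from_def)
  obtain \<pi> where \<pi>: "stationary_distribution (completion M) (\<lambda>N \<omega>. W G (path \<omega>) N) \<pi>"
    "\<And>u. pmf \<pi> u > 0 \<Longrightarrow> \<exists>a b. u = ?g a b"
    "\<And>u a b. (\<And>x. regenerative G x \<Longrightarrow> empty_at G x (- int (length a)) \<Longrightarrow>
        map x [- int (length a) + 1..0] = a \<Longrightarrow> map x [1..int (length b)] = b \<Longrightarrow> W G x 0 = u) \<Longrightarrow>
      pmf \<pi> u > 0"
    using window_process_stationary[of "W G" ?g] window by blast
  have "pmf \<pi> w > 0 \<longleftrightarrow>
      w = [] \<or> w \<noteq> [] \<and> exchanged_agent (w ! (length w - 1)) \<and> valid_old_record G w" for w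
  proof
    assume "pmf \<pi> w > 0"
    then obtain a b where w: "w = ?g a b" using \<pi>(2) by blast
    show "w = [] \<or> w \<noteq> [] \<and> exchanged_agent (w ! (length w - 1)) \<and> valid_old_record G w"
      unfolding w using valid_trim_end[OF valid_old_entries] trim_end_last by blast
  next
    assume w: "w = [] \<or> w \<noteq> [] \<and> exchanged_agent (w ! (length w - 1)) \<and> valid_old_record G w"
    then have "valid_old_record G w" by (auto simp: valid_old_record_def)
    then obtain q v where qv: "old_entries G q v = w" "old_queue G q v = []"
      using old_entries_surj[OF compatible_good_exists] by blast
    have eq: "trim_end w = w" using w by (intro trim_end_eq) blast
    let ?a = "map Agent q"
    show "pmf \<pi> w > 0"
    proof (rule \<pi>(3)[of ?a v])
      fix x assume x: "regenerative G x" "empty_at G x (- int (length ?a))"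
        "map x [- int (length ?a) + 1..0] = ?a" "map x [1..int (length v)] = v"
      have q: "queue_from G x (- int (length ?a)) 0 = q"
        using x(3) by (simp add: queue_from_def foldl_serve_agents)
      \<comment> \<open>Time \<open>length v\<close> need not be a regeneration;
        \<open>old_queue G q v = []\<close> is enough to end the window there.\<close>
      show "W G x 0 = w"
        using W_eq_trim_end[OF x(1,2), of 0 "int (length v)"] unfolding q
        by (simp add: x(4) qv eq)
    qed
  qed
  with \<pi>(1) show ?thesis by blast
qed

end

theorem theorem5:
  fixes G :: "('s::finite \<times> 'c::finite) set"
    and lam mu :: real
    and \<alpha> :: "'c \<Rightarrow> real" and \<beta> :: "'s \<Rightarrow> real"
    and M :: "'w measure"
    and z :: "int \<Rightarrow> 'w \<Rightarrow> ('c, 's) item"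
  assumes "lam > 0" and "mu > 0"
    and "\<And>c. \<alpha> c > 0" and "(\<Sum>c\<in>UNIV. \<alpha> c) = 1"
    and "\<And>s. \<beta> s > 0" and "(\<Sum>s\<in>UNIV. \<beta> s) = 1"
    and stability: "\<And>C. C \<noteq> {} \<Longrightarrow>
      (\<Sum>c\<in>C. lam * \<alpha> c) < (\<Sum>s\<in>compatible_goods G C. mu * \<beta> s)"
    and "prob_space M"
    and "prob_space.indep_vars M (\<lambda>_. count_space UNIV) z UNIV"
    and "\<And>n c. measure M {\<omega> \<in> space M. z n \<omega> = Agent c} = lam * \<alpha> c / (lam + mu)"
    and "\<And>n s. measure M {\<omega> \<in> space M. z n \<omega> = Good s} = mu * \<beta> s / (lam + mu)"
  shows "(\<exists>\<pi>. stationary_distribution (completion M) (\<lambda>N \<omega>. U G (\<lambda>n. z n \<omega>) N) \<pi> \<and>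
           (\<forall>u. pmf \<pi> u > 0 \<longleftrightarrow>
              u = [] \<or>
              (u \<noteq> [] \<and> (\<exists>c. u ! 0 = Plain (Agent c)) \<and>
               (\<forall>e\<in>set u. (\<exists>c. e = Plain (Agent c)) \<or> (\<exists>c. e = Exchanged (Agent c)) \<or>
                          (\<exists>s. e = Exchanged (Good s))) \<and>
               (\<forall>k l c s. k < l \<and> l < length u \<and>
                  u ! k = Plain (Agent c) \<and> u ! l = Exchanged (Good s) \<longrightarrow> (s, c) \<notin> G))))
       \<and> (\<exists>\<pi>. stationary_distribution (completion M) (\<lambda>N \<omega>. W G (\<lambda>n. z n \<omega>) N) \<pi> \<and>
           (\<forall>w. pmf \<pi> w > 0 \<longleftrightarrow>
              w = [] \<or>
              (w \<noteq> [] \<and> (\<exists>c. w ! (length w - 1) = Exchanged (Agent c)) \<and>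
               (\<forall>e\<in>set w. (\<exists>c. e = Plain (Agent c)) \<or> (\<exists>c. e = Exchanged (Agent c)) \<or>
                          (\<exists>s. e = Plain (Good s))) \<and>
               (\<forall>k l c s. l < k \<and> k < length w \<and>
                  w ! k = Exchanged (Agent c) \<and> w ! l = Plain (Good s) \<longrightarrow> (s, c) \<notin> G))))"
proof -
  interpret prob_space M by fact
  \<comment> \<open>The law of one item. Division by the total rate affects both sides of the
    stability condition alike, so it carries over to these probabilities.\<close>
  define f where "f i = (case i of Agent c \<Rightarrow> lam * \<alpha> c / (lam + mu) | Good s \<Rightarrow> mu * \<beta> s / (lam + mu))"
    for i
  have prob_z: "prob {\<omega> \<in> space M. z n \<omega> = i} = f i" for n i
    using assms(10,11) by (cases i) (simp_all add: f_def)
  have f_pos: "f i > 0" for i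
    using assms(1-3,5) by (cases i) (simp_all add: f_def)
  have "(\<Sum>i\<in>UNIV. f i) = (lam * (\<Sum>c\<in>UNIV. \<alpha> c) + mu * (\<Sum>s\<in>UNIV. \<beta> s)) / (lam + mu)"
    by (simp add: sum_item f_def sum_distrib_left sum_divide_distrib[symmetric] add_divide_distrib)
  then have f_sum: "(\<Sum>i\<in>UNIV. f i) = 1"
    using assms(1,2,4,6) by simp
  have "(\<integral>\<^sup>+i. ennreal (f i) \<partial>count_space UNIV) = ennreal (\<Sum>i\<in>UNIV. f i)"
    using f_pos by (simp add: nn_integral_count_space_finite[OF finite_item] sum_ennreal less_imp_le)
  then have pmf_f: "pmf (embed_pmf f) i = f i" for i
    using f_pos by (intro pmf_embed_pmf) (simp_all add: f_sum less_imp_le)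
  interpret fcfs_process G "embed_pmf f" M z
  proof unfold_locales
    show "pmf (embed_pmf f) i > 0" for i using f_pos by (simp add: pmf_f)
    show "(\<Sum>c\<in>C. pmf (embed_pmf f) (Agent c)) <
        (\<Sum>s\<in>compatible_goods G C. pmf (embed_pmf f) (Good s))" if "C \<noteq> {}" for C
      using stability[OF that] assms(1,2)
      by (simp add: pmf_f f_def sum_divide_distrib[symmetric] divide_strict_right_mono)
    show "indep_vars (\<lambda>_. count_space UNIV) z UNIV" by fact
    show "prob {\<omega> \<in> space M. z n \<omega> = i} = pmf (embed_pmf f) i" for n i
      by (simp add: prob_z pmf_f)
  qed
  show ?thesis
    using U_stationary W_stationary
    unfolding plain_agent_def exchanged_agent_def valid_record_nth valid_old_record_nth
    by (rule conjI)
qed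

end
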